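(* The 3-component Novikov system $$u_t+(upr)_x=0,\quad v_t+3vp_xr+v_xpr+u^2p=0,\quad w_t+3wpr_x+w_xpr-u^2r=0,\quad v=p-p_{xx},\ w=r-r_{xx},$$ is transformed by the Liouville transformation $$y=\int_{-\infty}^{x}u(\nu)\,d\nu,\qquad \tau=t,\qquad u_1(y)=P_1,\quad v_1(y)=P_2,\quad w_1(y)=P_3,$$ where $$P_1=2\frac{v_x}{vu}-3\frac{u_x}{u^2}-3\frac{vw}{u^3},$$ $$P_2=\frac{v_{xx}-v}{u^2v}-4\frac{u_xv_x}{u^3v}-\frac{4wv_x+2uu_{xx}-6u_x^2}{u^4}+6\frac{vwu_x}{u^5}+3\frac{v^2w^2}{u^6},$$ $$P_3=\frac{v(w-w_{xx})}{u^5}+\frac{4vw_xu_x+2vwu_{xx}}{u^6}-\frac{6vwu_x^2+3v^2ww_x+vw^2v_x}{u^7}+\frac{6v^2w^2u_x}{u^8}-\frac{v^3w^3}{u^9},$$ into the associated 3-Novikov system: with $Q_3=\frac{vw}{u^3}$ and $q_1=\frac{pu^2}{v}$ regarded as functions of $(y,\tau)$, $$\begin{aligned}u_{1\tau}&=-2q_{1y},\\ v_{1\tau}&=-q_{1yy}-u_1q_{1y}-2(Q_3q_1)_y,\\ w_{1\tau}&=-\left[Q_3q_{1y}+q_1\left(u_1Q_3+2Q_3^2-Q_{3y}\right)\right]_y,\end{aligned}$$ subject to $s_1=0$ and $s_2=0$, where $$s_1=q_{1yy}+q_1(2u_1Q_3+3Q_3^2+v_1)+q_{1y}(3Q_3+u_1)+1,$$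 $$s_2=w_1+Q_3\left(v_1+Q_3^2-3Q_{3y}-u_{1y}\right)+Q_{3yy}+(Q_3^2-Q_{3y})u_1.$$
   Context: All functions are smooth, with $u,v$ nonvanishing and $u$, together with the flux $upr$, decaying as $x\to-\infty$. The change of independent variables is the reciprocal transformation $dy=u\,dx-upr\,dt$, $d\tau=dt$ (consistent because $u_t=-(upr)_x$), so that $\partial_y=u^{-1}\partial_x$ and $\partial_\tau=\partial_t+pr\,\partial_x$. *)

theory Defs
  imports "HOL-Analysis.Analysis"
begin

text \<open>On an open set \<open>S\<close> of a finite-dimensional space, \<open>C_on n S f\<close> says that \<open>f\<close> is
  \<open>n\<close> times continuously differentiable: the recursion runs over directional derivatives,
  so that the type of \<open>f\<close> is preserved.\<close>

primrec C_on :: "nat \<Rightarrow> 'a::real_normed_vector set \<Rightarrow> ('a \<Rightarrow> 'b::real_normed_vector) \<Rightarrow> bool" where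
  "C_on 0 S f \<longleftrightarrow> continuous_on S f"
| "C_on (Suc n) S f \<longleftrightarrow> (\<forall>z\<in>S. f differentiable (at z)) \<and>
     (\<forall>h. C_on n S (\<lambda>z. frechet_derivative f (at z) h))"

definition smooth_on :: "'a::real_normed_vector set \<Rightarrow> ('a \<Rightarrow> 'b::real_normed_vector) \<Rightarrow> bool" where
  "smooth_on S f \<longleftrightarrow> (\<forall>n. C_on n S f)"

definition diffeomorphism_on :: "'a::real_normed_vector set \<Rightarrow> ('a \<Rightarrow> 'b::real_normed_vector) \<Rightarrow> bool" where
  "diffeomorphism_on S f \<longleftrightarrow> open S \<and> open (f ` S) \<and> inj_on f S \<and>
     smooth_on S f \<and> smooth_on (f ` S) (inv_into S f)"

text \<open>A field is a function of a pair \<open>(x, t)\<close>, or \<open>(y, \<tau>)\<close> in the new variables.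
  The two operators below are the partial derivatives in the first (space) and in the second
  (time) coordinate.\<close>

type_synonym field = "real \<times> real \<Rightarrow> real"

definition ds :: "field \<Rightarrow> field" where
  "ds f = (\<lambda>(x, t). deriv (\<lambda>\<xi>. f (\<xi>, t)) x)"

definition dt :: "field \<Rightarrow> field" where
  "dt f = (\<lambda>(x, t). deriv (\<lambda>\<sigma>. f (x, \<sigma>)) t)"

definition helmholtz :: "field \<Rightarrow> field" where
  "helmholtz f z = f z - ds (ds f) z"

text \<open>The system is considered for all real \<open>x\<close> and for \<open>t\<close> in an open set \<open>T\<close> of times.\<close>

definition novikov3 :: "real set \<Rightarrow> field \<Rightarrow> field \<Rightarrow> field \<Rightarrow> field \<Rightarrow> field \<Rightarrow> bool" where
  "novikov3 T u v w p r \<longleftrightarrow>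
     (\<forall>f\<in>{u, v, w, p, r}. smooth_on (UNIV \<times> T) f) \<and>
     (\<forall>z\<in>UNIV \<times> T.
        dt u z + ds (\<lambda>z. u z * p z * r z) z = 0 \<and>
        dt v z + 3 * v z * ds p z * r z + ds v z * p z * r z + (u z)\<^sup>2 * p z = 0 \<and>
        dt w z + 3 * w z * p z * ds r z + ds w z * p z * r z - (u z)\<^sup>2 * r z = 0 \<and>
        v z = helmholtz p z \<and>
        w z = helmholtz r z)"

text \<open>Integrability is what makes the new space variable well defined. That the flux
  vanishes locally uniformly in time is what allows to differentiate that variable in time under
  the integral sign, with no contribution from \<open>x = -\<infinity>\<close>.\<close>

definition decaying :: "real set \<Rightarrow> field \<Rightarrow> field \<Rightarrow> field \<Rightarrow> bool" where
  "decaying T u p r \<longleftrightarrow>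
     (\<forall>t\<in>T. \<forall>x. set_integrable lborel {..x} (\<lambda>\<nu>. u (\<nu>, t))) \<and>
     (\<forall>t\<in>T. ((\<lambda>x. u (x, t)) \<longlongrightarrow> 0) at_bot) \<and>
     (\<forall>K. compact K \<and> K \<subseteq> T \<longrightarrow>
        uniform_limit K (\<lambda>x t. u (x, t) * p (x, t) * r (x, t)) (\<lambda>_. 0) at_bot)"

definition liouville :: "field \<Rightarrow> real \<times> real \<Rightarrow> real \<times> real" where
  "liouville u = (\<lambda>(x, t). (set_lebesgue_integral lborel {..x} (\<lambda>\<nu>. u (\<nu>, t)), t))"

definition P1 :: "field \<Rightarrow> field \<Rightarrow> field \<Rightarrow> field" where
  "P1 u v w z =
     2 * (ds v z / (v z * u z)) - 3 * (ds u z / (u z)^2) - 3 * (v z * w z / (u z)^3)"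

definition P2 :: "field \<Rightarrow> field \<Rightarrow> field \<Rightarrow> field" where
  "P2 u v w z =
     (ds (ds v) z - v z) / ((u z)^2 * v z)
     - 4 * (ds u z * ds v z / ((u z)^3 * v z))
     - (4 * w z * ds v z + 2 * u z * ds (ds u) z - 6 * (ds u z)^2) / (u z)^4
     + 6 * (v z * w z * ds u z / (u z)^5)
     + 3 * ((v z)^2 * (w z)^2 / (u z)^6)"

definition P3 :: "field \<Rightarrow> field \<Rightarrow> field \<Rightarrow> field" where
  "P3 u v w z =
     v z * (w z - ds (ds w) z) / (u z)^5
     + (4 * v z * ds w z * ds u z + 2 * v z * w z * ds (ds u) z) / (u z)^6
     - (6 * v z * w z * (ds u z)^2 + 3 * (v z)^2 * w z * ds w z + v z * (w z)^2 * ds v z) / (u z)^7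
     + 6 * (v z)^2 * (w z)^2 * ds u z / (u z)^8
     - (v z)^3 * (w z)^3 / (u z)^9"

definition s1 :: "field \<Rightarrow> field \<Rightarrow> field \<Rightarrow> field \<Rightarrow> field" where
  "s1 u1 v1 Q3 q1 z =
     ds (ds q1) z + q1 z * (2 * u1 z * Q3 z + 3 * (Q3 z)\<^sup>2 + v1 z)
     + ds q1 z * (3 * Q3 z + u1 z) + 1"

definition s2 :: "field \<Rightarrow> field \<Rightarrow> field \<Rightarrow> field \<Rightarrow> field" where
  "s2 u1 v1 w1 Q3 z =
     w1 z + Q3 z * (v1 z + (Q3 z)\<^sup>2 - 3 * ds Q3 z - ds u1 z)
     + ds (ds Q3) z + ((Q3 z)\<^sup>2 - ds Q3 z) * u1 z"

definition associated_novikov3 ::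
    "(real \<times> real) set \<Rightarrow> field \<Rightarrow> field \<Rightarrow> field \<Rightarrow> field \<Rightarrow> field \<Rightarrow> bool" where
  "associated_novikov3 \<Omega> u1 v1 w1 Q3 q1 \<longleftrightarrow>
     (\<forall>f\<in>{u1, v1, w1, Q3, q1}. smooth_on \<Omega> f) \<and>
     (\<forall>z\<in>\<Omega>.
        dt u1 z = - 2 * ds q1 z \<and>
        dt v1 z = - ds (ds q1) z - u1 z * ds q1 z - 2 * ds (\<lambda>z. Q3 z * q1 z) z \<and>
        dt w1 z = - ds (\<lambda>z. Q3 z * ds q1 z
                     + q1 z * (u1 z * Q3 z + 2 * (Q3 z)\<^sup>2 - ds Q3 z)) z \<and>
        s1 u1 v1 Q3 q1 z = 0 \<and>
        s2 u1 v1 w1 Q3 z = 0)"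

end

theory Submission
  imports Defs
begin

text \<open>
  The derivative of \<open>liouville u\<close> is \<open>(h, k) \<mapsto> (u h - upr k, k)\<close>: its \<open>k\<close>-part comes from
  differentiating \<open>\<integral> u\<close> over \<open>[x - n, x]\<close> under the integral sign and letting
  \<open>n \<rightarrow> \<infinity>\<close>, where the uniformly vanishing flux gives locally uniform convergence of the
  derivatives. As \<open>u\<close> does not vanish, the map is injective, open by invariance of domain, and its
  inverse is smooth by bootstrapping \<open>D(L\<^sup>-\<^sup>1) = (DL)\<^sup>-\<^sup>1 \<circ> L\<^sup>-\<^sup>1\<close>.

  In the new variables, the logarithmic derivatives of \<open>u\<close> and \<open>v\<close> and a few monomials in
  \<open>u, v, w, p, r, p\<^sub>x, r\<^sub>x\<close> satisfy a closed system of polynomial equations,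
  and \<open>P\<^sub>1, P\<^sub>2, P\<^sub>3\<close> are differential polynomials in them; the associated system then
  consists of polynomial identities.
\<close>

section \<open>Calculus of smooth maps\<close>

lemma C_on_SucI:
  fixes f :: "'a::real_normed_vector \<Rightarrow> 'b::real_normed_vector"
  assumes "open S" "\<And>z. z \<in> S \<Longrightarrow> (f has_derivative f' z) (at z)" "\<And>h. C_on n S (\<lambda>z. f' z h)"
    and cong: "\<And>f g :: 'a \<Rightarrow> 'b. (\<And>z. z \<in> S \<Longrightarrow> f z = g z) \<Longrightarrow> C_on n S f \<Longrightarrow> C_on n S g"
  shows "C_on (Suc n) S f"
proof -
  \<comment> \<open>\<open>frechet_derivative f\<close> is known to agree with \<open>f'\<close>
    only on \<open>S\<close>, so congruence at order \<open>n\<close> is needed. It enters as an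
    assumption because \<open>C_on_cong\<close> is itself proved by induction through this lemma,
    with its induction hypothesis in that place.\<close>
  have "C_on n S (\<lambda>z. frechet_derivative f (at z) h)" for h
    by (rule cong[OF _ assms(3)]) (simp_all add: frechet_derivative_at[OF assms(2), symmetric])
  moreover have "\<forall>z\<in>S. f differentiable (at z)"
    using assms(2) differentiableI by blast
  ultimately show ?thesis by simp
qed

text \<open>At a point of an open set the derivative depends only on nearby values, all taken inside
  \<open>S\<close>; hence \<open>C_on\<close> does not see values off \<open>S\<close>, although it
  is phrased with \<open>at z\<close>.\<close>

lemma C_on_cong:
  assumes "open S" "\<And>z. z \<in> S \<Longrightarrow> f z = g z" "C_on n S f"
  shows "C_on n S g"
  using assms(2,3)
proof (induction n arbitrary: f g)
  case 0
  then show ?case using continuous_on_cong by (metis C_on.simps(1))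
next
  case (Suc n)
  show ?case
  proof (rule C_on_SucI[OF \<open>open S\<close>])
    fix z assume z: "z \<in> S"
    with Suc.prems(2) have "(f has_derivative frechet_derivative f (at z)) (at z)"
      by (auto simp: frechet_derivative_works)
    then show "(g has_derivative frechet_derivative f (at z)) (at z)"
      by (rule has_derivative_transform_within_open[OF _ \<open>open S\<close> z]) (rule Suc.prems(1))
  next
    show "C_on n S (\<lambda>z. frechet_derivative f (at z) h)" for h
      using Suc.prems(2) by simp
  qed (rule Suc.IH)
qed

lemma C_on_Suc:
  assumes "open S" "\<And>z. z \<in> S \<Longrightarrow> (f has_derivative f' z) (at z)" "\<And>h. C_on n S (\<lambda>z. f' z h)"
  shows "C_on (Suc n) S f"
  using C_on_SucI[OF assms] C_on_cong[OF \<open>open S\<close>] by blast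

lemma C_on_SucD:
  assumes "C_on (Suc n) S f"
  shows "z \<in> S \<Longrightarrow> (f has_derivative frechet_derivative f (at z)) (at z)"
    and "C_on n S (\<lambda>z. frechet_derivative f (at z) h)"
  using assms by (auto simp: frechet_derivative_works)

lemma C_on_Suc_lower:
  assumes "C_on (Suc n) S f"
  shows "C_on n S f"
  using assms
proof (induction n arbitrary: f)
  case 0
  then have "\<forall>z\<in>S. isCont f z"
    using differentiable_imp_continuous_within by auto
  then show ?case
    by (simp add: continuous_at_imp_continuous_on)
next
  case (Suc n)
  from Suc.prems have "\<forall>z\<in>S. f differentiable (at z)"
    and "\<And>h. C_on (Suc n) S (\<lambda>z. frechet_derivative f (at z) h)"
    by (auto simp del: C_on.simps(2) simp: C_on.simps(2)[of "Suc n"])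
  with Suc.IH show ?case by simp
qed

lemma C_on_const: "open S \<Longrightarrow> C_on n S (\<lambda>z. c)"
proof (induction n arbitrary: c)
  case (Suc n)
  then show ?case
    by (intro C_on_Suc[where f'="\<lambda>z h. 0"] has_derivative_const) auto
qed simp

lemma C_on_add:
  assumes "open S" "C_on n S f" "C_on n S g"
  shows "C_on n S (\<lambda>z. f z + g z)"
  using assms(2,3)
proof (induction n arbitrary: f g)
  case 0
  then show ?case by (simp add: continuous_on_add)
next
  case (Suc n)
  show ?case
    by (rule C_on_Suc[OF \<open>open S\<close> has_derivative_add[OF C_on_SucD(1) C_on_SucD(1)]])
       (use Suc in \<open>auto intro: C_on_SucD(2) simp del: C_on.simps\<close>)
qed

lemma C_on_sum:
  assumes "open S" "\<And>i. i \<in> I \<Longrightarrow> C_on n S (f i)"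
  shows "C_on n S (\<lambda>z. \<Sum>i\<in>I. f i z)"
  using assms(2) by (induction I rule: infinite_finite_induct) (auto intro: C_on_const C_on_add assms(1))

lemma C_on_bounded_linear:
  assumes "open S" "bounded_linear B" "C_on n S f"
  shows "C_on n S (\<lambda>z. B (f z))"
  using assms(3)
proof (induction n arbitrary: f)
  case 0
  then show ?case by (auto intro: bounded_linear.continuous_on assms)
next
  case (Suc n)
  show ?case
    by (rule C_on_Suc[OF \<open>open S\<close> bounded_linear.has_derivative[OF assms(2) C_on_SucD(1)]])
       (use Suc in \<open>auto intro: C_on_SucD(2) simp del: C_on.simps\<close>)
qed

text \<open>In the product rule each summand keeps one undifferentiated factor, known at order
  \<open>n + 1\<close> but used at order \<open>n\<close>; this is where
  \<open>C_on_Suc_lower\<close> comes in.\<close>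

lemma C_on_bounded_bilinear:
  assumes "open S" "bounded_bilinear B" "C_on n S f" "C_on n S g"
  shows "C_on n S (\<lambda>z. B (f z) (g z))"
  using assms(3,4)
proof (induction n arbitrary: f g)
  case 0
  then show ?case by (auto intro: bounded_bilinear.continuous_on assms)
next
  case (Suc n)
  show ?case
    by (rule C_on_Suc[OF \<open>open S\<close> bounded_bilinear.FDERIV[OF assms(2) C_on_SucD(1) C_on_SucD(1)]])
       (use Suc in \<open>auto intro!: C_on_add Suc.IH assms intro: C_on_SucD(2) C_on_Suc_lower simp del: C_on.simps\<close>)
qed

text \<open>The derivative \<open>- (1/f) * f' * (1/f)\<close> contains \<open>1/f\<close> only one
  order lower, so the induction closes on itself.\<close>

lemma C_on_inverse:
  fixes f :: "'a::real_normed_vector \<Rightarrow> real"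
  assumes "open S" "C_on n S f" "\<And>z. z \<in> S \<Longrightarrow> f z \<noteq> 0"
  shows "C_on n S (\<lambda>z. inverse (f z))"
  using assms(2)
proof (induction n)
  case 0
  then show ?case using assms(3) by (simp add: continuous_on_inverse)
next
  case (Suc n)
  note mult = C_on_bounded_bilinear[OF \<open>open S\<close> bounded_bilinear_mult]
  have "C_on n S (\<lambda>z. inverse (f z))"
    by (rule Suc.IH[OF C_on_Suc_lower[OF Suc.prems]])
  then show ?case
    by (intro C_on_Suc[OF \<open>open S\<close> Deriv.has_derivative_inverse[OF assms(3) C_on_SucD(1)[OF Suc.prems]]]
          C_on_bounded_linear[OF \<open>open S\<close> bounded_linear_minus[OF bounded_linear_ident]] mult
          C_on_SucD(2)[OF Suc.prems]) auto
qed

lemma C_on_Pair: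
  assumes "open S" "C_on n S f" "C_on n S g"
  shows "C_on n S (\<lambda>z. (f z, g z))"
proof -
  have "C_on n S (\<lambda>z. (f z, 0) + (0, g z))"
    by (intro C_on_add assms
          C_on_bounded_linear[OF \<open>open S\<close> bounded_linear_Pair[OF bounded_linear_ident bounded_linear_zero]]
          C_on_bounded_linear[OF \<open>open S\<close> bounded_linear_Pair[OF bounded_linear_zero bounded_linear_ident]])
  then show ?thesis by simp
qed

text \<open>In the chain rule the outer derivative is taken in the direction \<open>f' z h\<close>,
  which varies with \<open>z\<close>, whereas \<open>C_on\<close> speaks of fixed directions.
  Expanding that direction in \<open>Basis\<close> turns it into scalar coefficients times
  derivatives of \<open>g\<close> in fixed directions; this is why the middle space is
  Euclidean.\<close>

lemma C_on_compose:
  fixes f :: "'a::real_normed_vector \<Rightarrow> 'b::euclidean_space" and g :: "'b \<Rightarrow> 'c::real_normed_vector"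
  assumes "open S" "open S'" "f ` S \<subseteq> S'" "C_on n S f" "C_on n S' g"
  shows "C_on n S (\<lambda>z. g (f z))"
  using assms(4,5)
proof (induction n arbitrary: g)
  case 0
  then show ?case using assms(3) by (simp add: continuous_on_compose2)
next
  case (Suc n)
  let ?f' = "\<lambda>z. frechet_derivative f (at z)" and ?g' = "\<lambda>z. frechet_derivative g (at z)"
  show ?case
  proof (rule C_on_Suc[OF \<open>open S\<close>])
    fix z assume "z \<in> S"
    with assms(3) have "(g has_derivative ?g' (f z)) (at (f z))"
      by (intro C_on_SucD(1)[OF Suc.prems(2)]) auto
    moreover have f: "(f has_derivative ?f' z) (at z)"
      by (rule C_on_SucD(1)[OF Suc.prems(1) \<open>z \<in> S\<close>])
    ultimately have "((\<lambda>z. g (f z)) has_derivative (\<lambda>h. ?g' (f z) (?f' z h))) (at z)"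
      by (rule has_derivative_compose[rotated])
    moreover have "?g' (f z) (?f' z h) = (\<Sum>b\<in>Basis. (?f' z h \<bullet> b) *\<^sub>R ?g' (f z) b)" for h
    proof -
      have "linear (?g' (f z))"
        using \<open>(g has_derivative _) _\<close> by (rule has_derivative_linear)
      then have "?g' (f z) (\<Sum>b\<in>Basis. (?f' z h \<bullet> b) *\<^sub>R b) = (\<Sum>b\<in>Basis. (?f' z h \<bullet> b) *\<^sub>R ?g' (f z) b)"
        by (simp add: linear_sum linear_cmul)
      then show ?thesis by (simp add: euclidean_representation)
    qed
    ultimately show "((\<lambda>z. g (f z)) has_derivative
        (\<lambda>h. \<Sum>b\<in>Basis. (?f' z h \<bullet> b) *\<^sub>R ?g' (f z) b)) (at z)"
      by simp
  next
    fix h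
    show "C_on n S (\<lambda>z. \<Sum>b\<in>Basis. (?f' z h \<bullet> b) *\<^sub>R ?g' (f z) b)"
      by (intro C_on_sum \<open>open S\<close> C_on_bounded_bilinear[OF \<open>open S\<close> bounded_bilinear_scaleR]
            C_on_bounded_linear[OF \<open>open S\<close> bounded_linear_inner_left]
            C_on_SucD(2)[OF Suc.prems(1)] Suc.IH C_on_SucD(2)[OF Suc.prems(2)]
            C_on_Suc_lower[OF Suc.prems(1)])
  qed
qed

section \<open>Smooth maps and their closure properties\<close>

lemma smooth_on_cong:
  "open S \<Longrightarrow> smooth_on S f \<Longrightarrow> (\<And>z. z \<in> S \<Longrightarrow> f z = g z) \<Longrightarrow> smooth_on S g"
  by (simp add: smooth_on_def C_on_cong[of S f g])

lemma smooth_on_continuous: "smooth_on S f \<Longrightarrow> continuous_on S f"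
  by (metis C_on.simps(1) smooth_on_def)

lemma smooth_on_compose:
  fixes f :: "'a::real_normed_vector \<Rightarrow> 'b::euclidean_space"
  assumes "open S" "open S'" "f ` S \<subseteq> S'" "smooth_on S f" "smooth_on S' g"
  shows "smooth_on S (\<lambda>z. g (f z))"
  using assms(4,5) by (simp add: smooth_on_def C_on_compose[OF assms(1-3)])

lemma smooth_on_derivative:
  assumes "smooth_on S f"
  shows "z \<in> S \<Longrightarrow> (f has_derivative frechet_derivative f (at z)) (at z)"
    and "smooth_on S (\<lambda>z. frechet_derivative f (at z) h)"
  using assms unfolding smooth_on_def by (blast intro: C_on_SucD)+

lemma smooth_onI:
  assumes "open S" "\<And>z. z \<in> S \<Longrightarrow> (f has_derivative f' z) (at z)" "\<And>h. smooth_on S (\<lambda>z. f' z h)"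
  shows "smooth_on S f"
  using C_on_Suc[OF assms(1,2)] C_on_Suc_lower assms(3) by (metis smooth_on_def)

context
  fixes S :: "'a::real_normed_vector set"
  assumes S: "open S"
begin

lemma smooth_on_const: "smooth_on S (\<lambda>z. c)"
  using S by (simp add: smooth_on_def C_on_const)

lemma smooth_on_Pair: "smooth_on S f \<Longrightarrow> smooth_on S g \<Longrightarrow> smooth_on S (\<lambda>z. (f z, g z))"
  using S by (simp add: smooth_on_def C_on_Pair)

lemma smooth_on_add: "smooth_on S f \<Longrightarrow> smooth_on S g \<Longrightarrow> smooth_on S (\<lambda>z. f z + g z)"
  using S by (simp add: smooth_on_def C_on_add)

lemma smooth_on_uminus: "smooth_on S f \<Longrightarrow> smooth_on S (\<lambda>z. - f z)"
  using C_on_bounded_linear[OF S bounded_linear_minus[OF bounded_linear_ident]]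
  by (auto simp: smooth_on_def)

lemma smooth_on_diff: "smooth_on S f \<Longrightarrow> smooth_on S g \<Longrightarrow> smooth_on S (\<lambda>z. f z - g z)"
  using smooth_on_add[OF _ smooth_on_uminus, of f g] by simp

lemma smooth_on_mult:
  fixes f :: "'a \<Rightarrow> 'b::real_normed_algebra"
  shows "smooth_on S f \<Longrightarrow> smooth_on S g \<Longrightarrow> smooth_on S (\<lambda>z. f z * g z)"
  by (simp add: smooth_on_def C_on_bounded_bilinear[OF S bounded_bilinear_mult])

lemma smooth_on_power:
  fixes f :: "'a \<Rightarrow> 'b::real_normed_algebra_1"
  shows "smooth_on S f \<Longrightarrow> smooth_on S (\<lambda>z. f z ^ n)"
  by (induction n) (auto intro: smooth_on_const smooth_on_mult)

lemma smooth_on_divide: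
  fixes f g :: "'a \<Rightarrow> real"
  assumes "smooth_on S f" "smooth_on S g" "\<And>z. z \<in> S \<Longrightarrow> g z \<noteq> 0"
  shows "smooth_on S (\<lambda>z. f z / g z)"
  using smooth_on_mult[OF assms(1), of "\<lambda>z. inverse (g z)"] C_on_inverse[OF S _ assms(3)] assms(2)
  by (auto simp: smooth_on_def divide_inverse)

lemmas smooth_on_intros = smooth_on_const smooth_on_Pair smooth_on_add smooth_on_uminus
  smooth_on_diff smooth_on_mult smooth_on_power smooth_on_divide

end

section \<open>Partial derivatives of fields\<close>

lemma has_derivative_slices:
  fixes f :: field
  assumes "(f has_derivative f') (at (x, t))"
  shows "((\<lambda>\<xi>. f (\<xi>, t)) has_real_derivative f' (1, 0)) (at x)"
    and "((\<lambda>\<sigma>. f (x, \<sigma>)) has_real_derivative f' (0, 1)) (at t)"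
proof -
  have lin: "f' (c * h1, c * h2) = c * f' (h1, h2)" for c h1 h2
    using linear_cmul[OF has_derivative_linear[OF assms], of c "(h1, h2)"] by simp
  have "f' (h, 0) = f' (1, 0) * h" "f' (0, h) = f' (0, 1) * h" for h
    using lin[of h 1 0] lin[of h 0 1] by (simp_all add: mult.commute)
  then have lin1: "(\<lambda>h. f' (h, 0)) = (*) (f' (1, 0))" and lin2: "(\<lambda>h. f' (0, h)) = (*) (f' (0, 1))"
    by blast+
  have "((\<lambda>\<xi>. f (\<xi>, t)) has_derivative (\<lambda>h. f' (h, 0))) (at x)"
    by (rule has_derivative_compose[OF has_derivative_Pair[OF has_derivative_ident has_derivative_const] assms])
  then show "((\<lambda>\<xi>. f (\<xi>, t)) has_real_derivative f' (1, 0)) (at x)"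
    by (simp only: has_field_derivative_def lin1)
  have "((\<lambda>\<sigma>. f (x, \<sigma>)) has_derivative (\<lambda>h. f' (0, h))) (at t)"
    by (rule has_derivative_compose[OF has_derivative_Pair[OF has_derivative_const has_derivative_ident] assms])
  then show "((\<lambda>\<sigma>. f (x, \<sigma>)) has_real_derivative f' (0, 1)) (at t)"
    by (simp only: has_field_derivative_def lin2)
qed

lemma ds_dt_eq_derivative:
  assumes "(f has_derivative f') (at z)"
  shows "ds f z = f' (1, 0)" "dt f z = f' (0, 1)"
  using has_derivative_slices[of f f' "fst z" "snd z"] assms
  by (auto simp: ds_def dt_def case_prod_unfold intro: DERIV_imp_deriv)

lemma ds_eqI: "((\<lambda>\<xi>. f (\<xi>, t)) has_real_derivative d) (at x) \<Longrightarrow> ds f (x, t) = d"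
  and dt_eqI: "((\<lambda>\<sigma>. f (x, \<sigma>)) has_real_derivative d) (at t) \<Longrightarrow> dt f (x, t) = d"
  by (auto simp: ds_def dt_def intro: DERIV_imp_deriv)

lemma field_has_derivative:
  assumes "smooth_on S f" "z \<in> S"
  shows "(f has_derivative (\<lambda>h. fst h * ds f z + snd h * dt f z)) (at z)"
proof -
  let ?f' = "frechet_derivative f (at z)"
  have d: "(f has_derivative ?f') (at z)"
    by (rule smooth_on_derivative(1)[OF assms])
  then have lin: "linear ?f'" by (rule has_derivative_linear)
  have "?f' h = fst h * ds f z + snd h * dt f z" for h
  proof -
    have "?f' (fst h *\<^sub>R (1, 0) + snd h *\<^sub>R (0, 1)) = fst h * ds f z + snd h * dt f z"
      unfolding ds_dt_eq_derivative[OF d] linear_add[OF lin] linear_cmul[OF lin] by simp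
    then show ?thesis by simp
  qed
  then have "?f' = (\<lambda>h. fst h * ds f z + snd h * dt f z)" ..
  with d show ?thesis by simp
qed

lemma field_has_slice_derivatives:
  assumes "smooth_on S f" "(x, t) \<in> S"
  shows "((\<lambda>\<xi>. f (\<xi>, t)) has_real_derivative ds f (x, t)) (at x)"
    and "((\<lambda>\<sigma>. f (x, \<sigma>)) has_real_derivative dt f (x, t)) (at t)"
  using has_derivative_slices[OF field_has_derivative[OF assms]] by auto

text \<open>The partial derivatives are the derivatives in the directions \<open>(1, 0)\<close> and
  \<open>(0, 1)\<close>, and \<open>smooth_on\<close> is stable under directional
  derivatives.\<close>

lemma smooth_on_ds: "open S \<Longrightarrow> smooth_on S f \<Longrightarrow> smooth_on S (ds f)"
  and smooth_on_dt: "open S \<Longrightarrow> smooth_on S f \<Longrightarrow> smooth_on S (dt f)"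
  by (rule smooth_on_cong[OF _ smooth_on_derivative(2)];
      use ds_dt_eq_derivative[OF smooth_on_derivative(1)] in auto)+

lemma ds_dt_cong:
  assumes "open S" "\<And>z. z \<in> S \<Longrightarrow> f z = g z" "smooth_on S f" "z \<in> S"
  shows "ds f z = ds g z" "dt f z = dt g z"
proof -
  have f: "(f has_derivative (\<lambda>h. fst h * ds f z + snd h * dt f z)) (at z)"
    by (rule field_has_derivative[OF assms(3,4)])
  then have "(g has_derivative (\<lambda>h. fst h * ds f z + snd h * dt f z)) (at z)"
    by (rule has_derivative_transform_within_open[OF _ assms(1,4)]) (rule assms(2))
  from ds_dt_eq_derivative[OF this] show "ds f z = ds g z" "dt f z = dt g z" by auto
qed

text \<open>The classical criterion, with continuity asked of the second partial derivative. It is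
  applied on a product neighbourhood whose second factor is a ball, hence convex, as the mean value
  argument in that variable requires.\<close>

lemma field_has_derivative_partials:
  fixes f :: field
  assumes "open S"
    and fx: "\<And>\<xi> \<sigma>. (\<xi>, \<sigma>) \<in> S \<Longrightarrow> ((\<lambda>\<xi>. f (\<xi>, \<sigma>)) has_real_derivative fx (\<xi>, \<sigma>)) (at \<xi>)"
    and fy: "\<And>\<xi> \<sigma>. (\<xi>, \<sigma>) \<in> S \<Longrightarrow> ((\<lambda>\<sigma>. f (\<xi>, \<sigma>)) has_real_derivative fy (\<xi>, \<sigma>)) (at \<sigma>)"
    and cont: "continuous_on S fy"
    and "z \<in> S"
  shows "(f has_derivative (\<lambda>h. fx z * fst h + fy z * snd h)) (at z)"
proof -
  obtain x t where z: "z = (x, t)" by fastforce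
  obtain X Y' where "open X" "open Y'" "z \<in> X \<times> Y'" "X \<times> Y' \<subseteq> S"
    by (rule open_prod_elim[OF \<open>open S\<close> \<open>z \<in> S\<close>])
  then have "x \<in> X" "t \<in> Y'" by (auto simp: z)
  from \<open>open Y'\<close> this(2) obtain e where "e > 0" and e: "ball t e \<subseteq> Y'"
    using open_contains_ball_eq by blast
  define Y where "Y = ball t e"
  have Y: "open Y" "convex Y" "t \<in> Y" and XY: "X \<times> Y \<subseteq> S"
    using \<open>e > 0\<close> e \<open>X \<times> Y' \<subseteq> S\<close> by (auto simp: Y_def)
  have "((\<lambda>(x, y). f (x, y)) has_derivative (\<lambda>(tx, ty). fx (x, t) * tx + blinfun_mult_right (fy (x, t)) ty))
      (at (x, t) within X \<times> Y)"
  proof (rule has_derivative_partialsI[where fy="\<lambda>x y. blinfun_mult_right (fy (x, y))"])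
    show "((\<lambda>\<xi>. f (\<xi>, t)) has_derivative (*) (fx (x, t))) (at x within X)"
      using fx[of x t] XY \<open>x \<in> X\<close> \<open>t \<in> Y\<close>
      by (auto simp: has_field_derivative_def intro: has_derivative_at_withinI)
    show "((\<lambda>\<sigma>. f (\<xi>, \<sigma>)) has_derivative blinfun_apply (blinfun_mult_right (fy (\<xi>, \<sigma>)))) (at \<sigma> within Y)"
      if "\<xi> \<in> X" "\<sigma> \<in> Y" for \<xi> \<sigma>
      using fy[of \<xi> \<sigma>] XY that by (auto simp: has_field_derivative_def intro: has_derivative_at_withinI)
    have "continuous_on (X \<times> Y) fy"
      using cont XY by (rule continuous_on_subset)
    then have "continuous (at (x, t) within X \<times> Y) fy"
      using \<open>x \<in> X\<close> \<open>t \<in> Y\<close> by (simp add: continuous_on_eq_continuous_within)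
    from bounded_linear.continuous[OF bounded_linear_blinfun_mult_right this]
    show "continuous (at (x, t) within X \<times> Y) (\<lambda>(x, y). blinfun_mult_right (fy (x, y)))"
      by (simp add: case_prod_unfold)
  qed (use Y in auto)
  moreover have "at (x, t) within X \<times> Y = at (x, t)"
    using \<open>open X\<close> \<open>x \<in> X\<close> Y by (intro at_within_open) (auto intro: open_Times)
  ultimately show ?thesis
    by (simp add: z case_prod_unfold)
qed

section \<open>Integrals over space and equality of mixed partial derivatives\<close>

lemma integral_has_dt_derivative:
  fixes f :: field
  assumes "open S" "smooth_on S f" "{a..b} \<times> U \<subseteq> S" "open U" "convex U" "t \<in> U"
  shows "((\<lambda>\<sigma>. integral {a..b} (\<lambda>\<nu>. f (\<nu>, \<sigma>))) has_real_derivative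
          integral {a..b} (\<lambda>\<nu>. dt f (\<nu>, t))) (at t)"
proof -
  have "((\<lambda>\<sigma>. integral (cbox a b) (\<lambda>\<nu>. f (\<nu>, \<sigma>))) has_real_derivative
          integral (cbox a b) (\<lambda>\<nu>. dt f (\<nu>, t))) (at t within U)"
  proof (rule leibniz_rule_field_derivative)
    show "((\<lambda>\<sigma>. f (\<nu>, \<sigma>)) has_real_derivative dt f (\<nu>, \<sigma>)) (at \<sigma> within U)"
      if "\<sigma> \<in> U" "\<nu> \<in> cbox a b" for \<sigma> \<nu>
      by (intro has_field_derivative_at_within[OF field_has_slice_derivatives(2)[OF assms(2)]])
         (use that assms(3) in auto)
    show "(\<lambda>\<nu>. f (\<nu>, \<sigma>)) integrable_on cbox a b" if "\<sigma> \<in> U" for \<sigma>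
      by (intro integrable_continuous continuous_on_compose2[OF smooth_on_continuous[OF assms(2)]] continuous_intros)
         (use that assms(3) in auto)
    have "continuous_on S (dt f)"
      by (rule smooth_on_continuous[OF smooth_on_dt[OF assms(1,2)]])
    \<comment> \<open>The Leibniz rule puts the parameter first, while fields carry time as second
      coordinate; hence the swap.\<close>
    then have "continuous_on (U \<times> cbox a b) (\<lambda>z. dt f (snd z, fst z))"
      by (rule continuous_on_compose2) (use assms(3) in \<open>auto intro!: continuous_intros\<close>)
    then show "continuous_on (U \<times> cbox a b) (\<lambda>(\<sigma>, \<nu>). dt f (\<nu>, \<sigma>))"
      by (simp add: case_prod_unfold)
  qed (use assms in auto)
  then show ?thesis
    by (simp add: at_within_open[OF assms(6,4)])
qed

lemma integral_ds:
  fixes f :: field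
  assumes "smooth_on S f" "a \<le> b" "{a..b} \<times> {t} \<subseteq> S"
  shows "integral {a..b} (\<lambda>\<nu>. ds f (\<nu>, t)) = f (b, t) - f (a, t)"
proof (rule integral_unique, rule fundamental_theorem_of_calculus[OF assms(2)])
  fix \<nu> assume "\<nu> \<in> {a..b}"
  then have "((\<lambda>\<xi>. f (\<xi>, t)) has_real_derivative ds f (\<nu>, t)) (at \<nu> within {a..b})"
    by (intro has_field_derivative_at_within[OF field_has_slice_derivatives(1)[OF assms(1)]])
       (use assms(3) in auto)
  then show "((\<lambda>\<xi>. f (\<xi>, t)) has_vector_derivative ds f (\<nu>, t)) (at \<nu> within {a..b})"
    by (simp add: has_real_derivative_iff_has_vector_derivative)
qed

text \<open>Differentiate \<open>f (x, t) = f (a, t) + \<integral> ds f\<close> first in \<open>t\<close>, under the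
  integral sign, and then in \<open>x\<close>.\<close>

lemma ds_dt_commute:
  fixes f :: field
  assumes "open S" "smooth_on S f" "z \<in> S"
  shows "ds (dt f) z = dt (ds f) z"
proof -
  obtain x t where z: "z = (x, t)" by fastforce
  obtain X U' where "open X" "open U'" "z \<in> X \<times> U'" "X \<times> U' \<subseteq> S"
    by (rule open_prod_elim[OF \<open>open S\<close> \<open>z \<in> S\<close>])
  then have "x \<in> X" "t \<in> U'" by (auto simp: z)
  with \<open>open X\<close> \<open>open U'\<close> obtain d e where "d > 0" "e > 0" and de: "cball x d \<subseteq> X" "ball t e \<subseteq> U'"
    using open_contains_ball_eq open_contains_cball_eq by meson
  define a b U where "a = x - d" and "b = x + d" and "U = ball t e"
  have U: "open U" "convex U" "t \<in> U" and x: "a < x" "x < b" and S: "{a..b} \<times> U \<subseteq> S"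
    using \<open>e > 0\<close> \<open>d > 0\<close> de \<open>X \<times> U' \<subseteq> S\<close>
    by (auto simp: U_def a_def b_def cball_eq_atLeastAtMost)
  have S': "(a, t) \<in> S" using S U x by auto
  have sds: "smooth_on S (ds f)" and sdt: "smooth_on S (dt (ds f))"
    using assms by (auto intro: smooth_on_ds smooth_on_dt)
  have dt_eq: "dt f (\<xi>, t) = dt f (a, t) + integral {a..\<xi>} (\<lambda>\<nu>. dt (ds f) (\<nu>, t))"
    if "\<xi> \<in> {a..b}" for \<xi>
  proof (rule dt_eqI)
    have "{a..\<xi>} \<times> U \<subseteq> S" using S that by auto
    then have "((\<lambda>\<sigma>. f (a, \<sigma>) + integral {a..\<xi>} (\<lambda>\<nu>. ds f (\<nu>, \<sigma>))) has_real_derivative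
        dt f (a, t) + integral {a..\<xi>} (\<lambda>\<nu>. dt (ds f) (\<nu>, t))) (at t)"
      using S' U by (intro DERIV_add field_has_slice_derivatives(2)[OF assms(2)]
            integral_has_dt_derivative[OF assms(1) sds]) auto
    then show "((\<lambda>\<sigma>. f (\<xi>, \<sigma>)) has_real_derivative
        dt f (a, t) + integral {a..\<xi>} (\<lambda>\<nu>. dt (ds f) (\<nu>, t))) (at t)"
    proof (rule has_field_derivative_transform_within_open[OF _ U(1,3)])
      fix \<sigma> assume "\<sigma> \<in> U"
      then have "{a..\<xi>} \<times> {\<sigma>} \<subseteq> S" using S that by auto
      from integral_ds[OF assms(2) _ this] that
      show "f (a, \<sigma>) + integral {a..\<xi>} (\<lambda>\<nu>. ds f (\<nu>, \<sigma>)) = f (\<xi>, \<sigma>)" by auto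
    qed
  qed
  have "continuous_on {a..b} (\<lambda>\<nu>. dt (ds f) (\<nu>, t))"
    by (intro continuous_on_compose2[OF smooth_on_continuous[OF sdt]] continuous_intros) (use S U in auto)
  from integral_has_real_derivative[OF this, of x] x
  have "((\<lambda>\<xi>. integral {a..\<xi>} (\<lambda>\<nu>. dt (ds f) (\<nu>, t))) has_real_derivative dt (ds f) (x, t)) (at x)"
    by (simp add: at_within_Icc_at)
  from DERIV_add[OF DERIV_const[of "dt f (a, t)"] this]
  have "((\<lambda>\<xi>. dt f (a, t) + integral {a..\<xi>} (\<lambda>\<nu>. dt (ds f) (\<nu>, t))) has_real_derivative dt (ds f) (x, t)) (at x)"
    by simp
  then have "((\<lambda>\<xi>. dt f (\<xi>, t)) has_real_derivative dt (ds f) (x, t)) (at x)"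
    by (rule has_field_derivative_transform_within_open[of _ _ _ "{a<..<b}"])
       (simp_all add: x dt_eq[symmetric])
  then show ?thesis
    unfolding z by (rule ds_eqI)
qed

section \<open>Reciprocal transformations\<close>

text \<open>The change of variables \<open>dy = u dx - \<phi> dt\<close>, \<open>d\<tau> = dt\<close> attached to a conservation
  law with density \<open>u\<close> and flux \<open>\<phi>\<close>.\<close>

locale reciprocal_transformation =
  fixes T :: "real set" and u \<phi> :: field
  assumes open_T: "open T"
    and smooth_u: "smooth_on (UNIV \<times> T) u"
    and smooth_\<phi>: "smooth_on (UNIV \<times> T) \<phi>"
    and u_nonzero: "z \<in> UNIV \<times> T \<Longrightarrow> u z \<noteq> 0"
    and conservation: "z \<in> UNIV \<times> T \<Longrightarrow> dt u z = - ds \<phi> z"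
    and integrable: "t \<in> T \<Longrightarrow> set_integrable lborel {..x} (\<lambda>\<nu>. u (\<nu>, t))"
    and flux_vanishes: "compact K \<Longrightarrow> K \<subseteq> T \<Longrightarrow> uniform_limit K (\<lambda>x t. \<phi> (x, t)) (\<lambda>_. 0) at_bot"
begin

section \<open>The new space variable and its partial derivatives\<close>

definition Y :: field where "Y z = fst (liouville u z)"

definition \<Omega> where "\<Omega> = liouville u ` (UNIV \<times> T)"

definition liouville_inv where "liouville_inv = inv_into (UNIV \<times> T) (liouville u)"

lemma open_domain: "open (UNIV \<times> T)"
  using open_T by (simp add: open_Times)

lemma liouville_eq: "liouville u z = (Y z, snd z)"
  by (simp add: Y_def liouville_def case_prod_unfold)

lemma continuous_on_slice: "t \<in> T \<Longrightarrow> continuous_on A (\<lambda>\<nu>. u (\<nu>, t))"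
  by (intro continuous_on_compose2[OF smooth_on_continuous[OF smooth_u]] continuous_intros) auto

text \<open>Passes from the Lebesgue integral of the definition to the gauge integral, in which
  intervals can be split and the fundamental theorem applied.\<close>

lemma Y_eq_integral:
  assumes "t \<in> T"
  shows "((\<lambda>\<nu>. u (\<nu>, t)) has_integral Y (x, t)) {..x}"
  using set_borel_integral_eq_integral[OF integrable[OF assms]]
  by (simp add: Y_def liouville_def integrable_integral)

text \<open>Confines the improper part of the integral to a term independent of \<open>x\<close>, so
  that only an integral over a compact interval has to be differentiated in space.\<close>

lemma Y_split:
  assumes "t \<in> T" "a \<le> x"
  shows "Y (x, t) = Y (a, t) + integral {a..x} (\<lambda>\<nu>. u (\<nu>, t))"
proof -
  have "((\<lambda>\<nu>. u (\<nu>, t)) has_integral integral {a..x} (\<lambda>\<nu>. u (\<nu>, t))) {a..x}"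
    using continuous_on_slice[OF assms(1)]
    by (intro integrable_integral integrable_continuous_interval)
  moreover have "negligible ({..a} \<inter> {a..x})"
    by (rule negligible_subset[of "{a}"]) auto
  ultimately
  have "((\<lambda>\<nu>. u (\<nu>, t)) has_integral Y (a, t) + integral {a..x} (\<lambda>\<nu>. u (\<nu>, t))) ({..a} \<union> {a..x})"
    by (rule has_integral_Un[OF Y_eq_integral[OF assms(1)]])
  moreover have "{..a} \<union> {a..x} = {..x}" using assms(2) by auto
  ultimately show ?thesis
    using Y_eq_integral[OF assms(1), of x] has_integral_unique by metis
qed

lemma Y_x:
  assumes "t \<in> T"
  shows "((\<lambda>\<xi>. Y (\<xi>, t)) has_real_derivative u (x, t)) (at x)"
proof -
  \<comment> \<open>The base point \<open>x - 1\<close> makes \<open>x\<close> an interior point of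
    the interval, so the derivative within it is two-sided.\<close>
  have "((\<lambda>\<xi>. integral {x-1..\<xi>} (\<lambda>\<nu>. u (\<nu>, t))) has_real_derivative u (x, t)) (at x within {x-1..x+1})"
    by (rule integral_has_real_derivative[OF continuous_on_slice[OF assms]]) auto
  then have "((\<lambda>\<xi>. integral {x-1..\<xi>} (\<lambda>\<nu>. u (\<nu>, t))) has_real_derivative u (x, t)) (at x)"
    by (simp add: at_within_Icc_at)
  from DERIV_add[OF DERIV_const[of "Y (x - 1, t)"] this]
  have "((\<lambda>\<xi>. Y (x - 1, t) + integral {x-1..\<xi>} (\<lambda>\<nu>. u (\<nu>, t))) has_real_derivative u (x, t)) (at x)"
    by simp
  then show ?thesis
    by (rule has_field_derivative_transform_within_open[of _ _ _ "{x-1<..}"])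
       (simp_all add: Y_split[OF assms, symmetric])
qed

text \<open>The lower limit is sampled along \<open>x - n\<close> because termwise differentiation
  is applied below to a sequence of functions.\<close>

lemma Y_limit:
  assumes "t \<in> T"
  shows "(\<lambda>n. integral {x - real n..x} (\<lambda>\<nu>. u (\<nu>, t))) \<longlonglongrightarrow> Y (x, t)"
proof -
  have "((\<lambda>a. set_lebesgue_integral lborel {a..x} (\<lambda>\<nu>. u (\<nu>, t))) \<longlongrightarrow> Y (x, t)) at_bot"
    using tendsto_set_lebesgue_integral_at_bot[OF _ integrable[OF assms], of x]
    by (simp add: Y_def liouville_def)
  moreover have "set_lebesgue_integral lborel {a..x} (\<lambda>\<nu>. u (\<nu>, t)) = integral {a..x} (\<lambda>\<nu>. u (\<nu>, t))" for a
    by (intro set_borel_integral_eq_integral set_integrable_subset[OF integrable[OF assms]]) auto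
  moreover have "filterlim (\<lambda>n. x - real n) at_bot sequentially"
    by real_asymp
  ultimately show ?thesis
    using filterlim_compose by fastforce
qed

lemma Y_t:
  assumes "t \<in> T"
  shows "((\<lambda>\<sigma>. Y (x, \<sigma>)) has_real_derivative - \<phi> (x, t)) (at t)"
proof -
  obtain e where "e > 0" and e: "cball t e \<subseteq> T"
    using open_T assms open_contains_cball_eq by blast
  define J where "J n \<sigma> = integral {x - real n..x} (\<lambda>\<nu>. u (\<nu>, \<sigma>))" for n \<sigma>
  have J: "(J n has_derivative (\<lambda>h. (\<phi> (x - real n, \<sigma>) - \<phi> (x, \<sigma>)) * h)) (at \<sigma> within cball t e)"
    if "\<sigma> \<in> cball t e" for n \<sigma>
  proof -
    have "\<sigma> \<in> T" using that e by blast
    with open_T obtain d where "d > 0" and d: "ball \<sigma> d \<subseteq> T"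
      using open_contains_ball_eq by blast
    \<comment> \<open>The conservation law turns the time derivative of the truncated integral into
      a difference of boundary fluxes.\<close>
    have "integral {x - real n..x} (\<lambda>\<nu>. dt u (\<nu>, \<sigma>)) = integral {x - real n..x} (\<lambda>\<nu>. - ds \<phi> (\<nu>, \<sigma>))"
      using \<open>\<sigma> \<in> T\<close> by (intro integral_cong conservation) simp
    also have "\<dots> = \<phi> (x - real n, \<sigma>) - \<phi> (x, \<sigma>)"
      using integral_ds[OF smooth_\<phi>, of "x - real n" x \<sigma>] \<open>\<sigma> \<in> T\<close> by (simp add: subset_iff)
    finally have "(J n has_real_derivative \<phi> (x - real n, \<sigma>) - \<phi> (x, \<sigma>)) (at \<sigma>)"
      using integral_has_dt_derivative[OF open_domain smooth_u, of "x - real n" x "ball \<sigma> d" \<sigma>] \<open>d > 0\<close> d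
      by (simp add: J_def[abs_def] Sigma_mono)
    then show ?thesis
      by (auto simp: has_field_derivative_def intro: has_derivative_at_withinI)
  qed
  \<comment> \<open>Termwise differentiation: the derivatives converge uniformly because the flux at
    \<open>x - n\<close> vanishes uniformly on the compact ball of times, and the functions
    themselves converge at the one time \<open>t\<close>.\<close>
  have "\<exists>g. \<forall>\<sigma>\<in>cball t e. (\<lambda>n. J n \<sigma>) \<longlonglongrightarrow> g \<sigma> \<and>
      (g has_derivative (*) (- \<phi> (x, \<sigma>))) (at \<sigma> within cball t e)"
  proof (rule has_derivative_sequence[where f=J and ?x0.0=t and l="Y (x, t)", OF _ J])
    fix \<epsilon> :: real assume "\<epsilon> > 0"
    have "filterlim (\<lambda>n. x - real n) at_bot sequentially"
      by real_asymp
    with uniform_limitD[OF flux_vanishes[OF compact_cball e] \<open>\<epsilon> > 0\<close>]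
    have "\<forall>\<^sub>F n in sequentially. \<forall>\<sigma>\<in>cball t e. dist (\<phi> (x - real n, \<sigma>)) 0 < \<epsilon>"
      by (rule eventually_compose_filterlim)
    then show "\<forall>\<^sub>F n in sequentially. \<forall>\<sigma>\<in>cball t e. \<forall>h.
        norm ((\<phi> (x - real n, \<sigma>) - \<phi> (x, \<sigma>)) * h - - \<phi> (x, \<sigma>) * h) \<le> \<epsilon> * norm h"
    proof (rule eventually_mono, intro ballI allI)
      fix n \<sigma> h
      assume "\<forall>\<sigma>\<in>cball t e. dist (\<phi> (x - real n, \<sigma>)) 0 < \<epsilon>" "\<sigma> \<in> cball t e"
      then have "\<bar>\<phi> (x - real n, \<sigma>)\<bar> \<le> \<epsilon>" by fastforce
      then have "norm (\<phi> (x - real n, \<sigma>) * h) \<le> \<epsilon> * norm h"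
        by (simp add: abs_mult mult_right_mono)
      then show "norm ((\<phi> (x - real n, \<sigma>) - \<phi> (x, \<sigma>)) * h - - \<phi> (x, \<sigma>) * h) \<le> \<epsilon> * norm h"
        by (simp add: algebra_simps)
    qed
  next
    show "(\<lambda>n. J n t) \<longlonglongrightarrow> Y (x, t)"
      unfolding J_def by (rule Y_limit[OF assms])
  qed (use \<open>e > 0\<close> in auto)
  then obtain g where g: "\<And>\<sigma>. \<sigma> \<in> cball t e \<Longrightarrow> (\<lambda>n. J n \<sigma>) \<longlonglongrightarrow> g \<sigma>"
    and gd: "\<And>\<sigma>. \<sigma> \<in> cball t e \<Longrightarrow> (g has_derivative (*) (- \<phi> (x, \<sigma>))) (at \<sigma> within cball t e)"
    by blast
  have "at t within cball t e = at t"
    using \<open>e > 0\<close> by (intro at_within_interior) (simp add: interior_cball)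
  then have "(g has_real_derivative - \<phi> (x, t)) (at t)"
    using gd[of t] \<open>e > 0\<close> by (simp add: has_field_derivative_def del: mult_minus_left)
  then show ?thesis
  proof (rule has_field_derivative_transform_within_open[of _ _ _ "ball t e"])
    \<comment> \<open>The limit \<open>g\<close> is so far anonymous; uniqueness of limits
      identifies it with \<open>Y (x, \<sigma>)\<close> on a neighbourhood of \<open>t\<close>,
      which is enough for the derivative at \<open>t\<close>.\<close>
    fix \<sigma> assume "\<sigma> \<in> ball t e"
    then have "\<sigma> \<in> cball t e" "\<sigma> \<in> T" using e by auto
    then show "g \<sigma> = Y (x, \<sigma>)"
      using LIMSEQ_unique[OF g[of \<sigma>]] Y_limit[of \<sigma> x] by (simp add: J_def)
  qed (use \<open>e > 0\<close> in auto)
qed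

lemma liouville_has_derivative:
  assumes "z \<in> UNIV \<times> T"
  shows "(liouville u has_derivative (\<lambda>h. (u z * fst h - \<phi> z * snd h, snd h))) (at z)"
proof -
  have "(Y has_derivative (\<lambda>h. u z * fst h + - \<phi> z * snd h)) (at z)"
    using smooth_on_continuous[OF smooth_\<phi>] Y_x Y_t assms
    by (intro field_has_derivative_partials[OF open_domain, where fy="\<lambda>z. - \<phi> z"] continuous_intros) auto
  then have "((\<lambda>z. (Y z, snd z)) has_derivative (\<lambda>h. (u z * fst h + - \<phi> z * snd h, snd h))) (at z)"
    by (intro has_derivative_Pair bounded_linear_imp_has_derivative bounded_linear_snd)
  then show ?thesis
    by (simp add: liouville_eq[abs_def])
qed

lemma smooth_liouville: "smooth_on (UNIV \<times> T) (liouville u)"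
  by (rule smooth_onI[OF open_domain liouville_has_derivative])
     (auto intro!: smooth_on_intros open_domain smooth_u smooth_\<phi>)

section \<open>The inverse transformation\<close>

lemma inj_liouville: "inj_on (liouville u) (UNIV \<times> T)"
proof (rule inj_onI)
  fix z z' assume z: "z \<in> UNIV \<times> T" "z' \<in> UNIV \<times> T" and eq: "liouville u z = liouville u z'"
  obtain x x' t where zs: "z = (x, t)" "z' = (x', t)"
    using eq by (metis liouville_eq prod.collapse prod.inject)
  have "t \<in> T" using z zs by auto
  \<comment> \<open>Time is preserved, so only points of one time slice can collide; by Rolle such a
    collision would give a zero of \<open>u\<close>, the space derivative of
    \<open>Y\<close>.\<close>
  have False if "a < b" "Y (a, t) = Y (b, t)" for a b
  proof -
    have "continuous_on {a..b} (\<lambda>\<xi>. Y (\<xi>, t))"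
      by (rule DERIV_continuous_on) (rule has_field_derivative_at_within[OF Y_x[OF \<open>t \<in> T\<close>]])
    then have "\<exists>c>a. c < b \<and> (*) (u (c, t)) = (\<lambda>h. 0)"
      by (intro Rolle_deriv[of a b "\<lambda>\<xi>. Y (\<xi>, t)"] that Y_x[OF \<open>t \<in> T\<close>, unfolded has_field_derivative_def])
    then obtain c where "(*) (u (c, t)) = (\<lambda>h. 0)" by blast
    then have "u (c, t) * 1 = 0" by metis
    with u_nonzero[of "(c, t)"] \<open>t \<in> T\<close> show False by simp
  qed
  with eq show "z = z'"
    by (metis liouville_eq linorder_neqE prod.inject zs)
qed

lemma open_\<Omega>: "open \<Omega>"
  unfolding \<Omega>_def
  by (rule invariance_of_domain[OF smooth_on_continuous[OF smooth_liouville] open_domain inj_liouville])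

lemma liouville_inv_in: "z \<in> \<Omega> \<Longrightarrow> liouville_inv z \<in> UNIV \<times> T"
  unfolding liouville_inv_def \<Omega>_def by (rule inv_into_into)

lemma liouville_inv_right: "z \<in> \<Omega> \<Longrightarrow> liouville u (liouville_inv z) = z"
  unfolding liouville_inv_def \<Omega>_def by (rule f_inv_into_f)

lemma liouville_inv_left: "z \<in> UNIV \<times> T \<Longrightarrow> liouville_inv (liouville u z) = z"
  unfolding liouville_inv_def by (rule inv_into_f_f[OF inj_liouville])

text \<open>The formula is the inverse of the triangular linear map
  \<open>(h, k) \<mapsto> (u h - \<phi> k, k)\<close>. Continuity of the inverse map, the remaining
  input of the inverse rule, comes from a continuous injection between sets of equal dimension being
  open.\<close>

lemma liouville_inv_has_derivative:
  assumes "z \<in> \<Omega>"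
  shows "(liouville_inv has_derivative
    (\<lambda>h. (fst h / u (liouville_inv z) + \<phi> (liouville_inv z) / u (liouville_inv z) * snd h, snd h))) (at z)"
proof -
  let ?w = "liouville_inv z"
  have u: "u ?w \<noteq> 0"
    by (rule u_nonzero[OF liouville_inv_in[OF assms]])
  show ?thesis
  proof (rule has_derivative_inverse_basic[where g=liouville_inv and y=z,
        OF liouville_has_derivative[OF liouville_inv_in[OF assms]] _ _ _ open_\<Omega> assms])
    show "bounded_linear (\<lambda>h. (fst h / u ?w + \<phi> ?w / u ?w * snd h, snd h))"
      by (intro bounded_linear_Pair bounded_linear_add bounded_linear_snd
          bounded_linear_const_mult bounded_linear_compose[OF bounded_linear_divide bounded_linear_fst])
    show "(\<lambda>h. (fst h / u ?w + \<phi> ?w / u ?w * snd h, snd h)) \<circ> (\<lambda>h. (u ?w * fst h - \<phi> ?w * snd h, snd h)) = id"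
      using u by (auto simp: fun_eq_iff field_simps)
    have "continuous_on \<Omega> liouville_inv"
      unfolding \<Omega>_def
      by (rule continuous_on_inverse_open[OF open_domain smooth_on_continuous[OF smooth_liouville] _ liouville_inv_left]) auto
    then show "isCont liouville_inv z"
      using open_\<Omega> assms continuous_on_eq_continuous_at by blast
  qed (rule liouville_inv_right)
qed

text \<open>The derivative of the inverse is a smooth map composed with the inverse itself. Order
  \<open>n\<close> for the inverse thus gives order \<open>n\<close> for its derivative, that is
  order \<open>n + 1\<close>; arguing with all orders at once would be circular.\<close>

lemma smooth_liouville_inv: "smooth_on \<Omega> liouville_inv"
  unfolding smooth_on_def
proof
  have sm: "smooth_on (UNIV \<times> T) (\<lambda>w. (fst h / u w + \<phi> w / u w * snd h, snd h))" for h :: "real \<times> real"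
    by (intro smooth_on_intros open_domain smooth_u smooth_\<phi> u_nonzero)
  fix n show "C_on n \<Omega> liouville_inv"
  proof (induction n)
    case 0
    show ?case
      using liouville_inv_has_derivative
      by (auto intro!: continuous_at_imp_continuous_on has_derivative_continuous)
  next
    case (Suc n)
    show ?case
    proof (rule C_on_Suc[OF open_\<Omega> liouville_inv_has_derivative])
      fix h :: "real \<times> real"
      show "C_on n \<Omega> (\<lambda>z. (fst h / u (liouville_inv z) +
          \<phi> (liouville_inv z) / u (liouville_inv z) * snd h, snd h))"
      proof (rule C_on_compose[OF open_\<Omega> open_domain _ Suc.IH])
        show "liouville_inv ` \<Omega> \<subseteq> UNIV \<times> T"
          using liouville_inv_in by blast
        show "C_on n (UNIV \<times> T) (\<lambda>w. (fst h / u w + \<phi> w / u w * snd h, snd h))"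
          using sm smooth_on_def by blast
      qed
    qed
  qed
qed

lemma diffeomorphism_liouville: "diffeomorphism_on (UNIV \<times> T) (liouville u)"
  using open_domain open_\<Omega> inj_liouville smooth_liouville smooth_liouville_inv
  by (simp add: diffeomorphism_on_def \<Omega>_def liouville_inv_def)

section \<open>Fields expressed in the new variables\<close>

definition pull :: "field \<Rightarrow> field" where "pull f = (\<lambda>z. f (liouville_inv z))"

lemma smooth_pull: "smooth_on (UNIV \<times> T) f \<Longrightarrow> smooth_on \<Omega> (pull f)"
  unfolding pull_def
  by (rule smooth_on_compose[OF open_\<Omega> open_domain _ smooth_liouville_inv])
     (use liouville_inv_in in blast)

text \<open>The columns of the inverse Jacobian: the new derivatives are \<open>1/u\<close> times
  the old space derivative, and the old time derivative plus \<open>\<phi>/u\<close> times the old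
  space derivative.\<close>

lemma pull_derivatives:
  assumes "smooth_on (UNIV \<times> T) f" "z \<in> \<Omega>"
  shows "ds (pull f) z = pull (ds f) z / pull u z"
    and "dt (pull f) z = pull (dt f) z + pull \<phi> z / pull u z * pull (ds f) z"
  using ds_dt_eq_derivative[OF has_derivative_compose[OF liouville_inv_has_derivative[OF assms(2)]
        field_has_derivative[OF assms(1) liouville_inv_in[OF assms(2)]]]]
  by (simp_all add: pull_def)

end

section \<open>The reduced system\<close>

text \<open>In the new variables the flow closes up polynomially in
  \<open>a = v\<^sub>y / v\<close>, \<open>b = u\<^sub>y / u\<close>, \<open>Q = v w / u\<^sup>3\<close>, \<open>q = p u\<^sup>2 / v\<close>, \<open>m = v r / u\<close>,
  \<open>\<alpha> = u p\<^sub>x / v\<close>, \<open>\<beta> = v r\<^sub>x / u\<^sup>2\<close> and \<open>e = 1 / u\<^sup>2\<close>. The evolution of \<open>a\<close> and \<open>b\<close> is the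
  \<open>y\<close>-derivative of that of \<open>ln \<bar>v\<bar>\<close> and \<open>ln \<bar>u\<bar>\<close>, where \<open>\<alpha> m = p\<^sub>x r\<close> and \<open>q \<beta> = p r\<^sub>x\<close>.\<close>

locale reduced_system =
  fixes S :: "(real \<times> real) set" and a b Q q m \<alpha> \<beta> e :: field
  assumes open_S: "open S"
    and smooth: "smooth_on S a" "smooth_on S b" "smooth_on S Q" "smooth_on S q"
      "smooth_on S m" "smooth_on S \<alpha>" "smooth_on S \<beta>" "smooth_on S e"
    and ds_q: "z \<in> S \<Longrightarrow> ds q z = q z * (2 * b z - a z) + \<alpha> z"
    and ds_\<alpha>: "z \<in> S \<Longrightarrow> ds \<alpha> z = q z * e z - 1 + \<alpha> z * (b z - a z)"
    and ds_m: "z \<in> S \<Longrightarrow> ds m z = \<beta> z + m z * (a z - b z)"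
    and ds_\<beta>: "z \<in> S \<Longrightarrow> ds \<beta> z = m z * e z - Q z + \<beta> z * (a z - 2 * b z)"
    and ds_e: "z \<in> S \<Longrightarrow> ds e z = - 2 * b z * e z"
    and dt_a: "z \<in> S \<Longrightarrow> dt a z = ds (\<lambda>z. - 3 * (\<alpha> z * m z) - q z) z"
    and dt_b: "z \<in> S \<Longrightarrow> dt b z = ds (\<lambda>z. - (\<alpha> z * m z) - q z * \<beta> z) z"
    and dt_Q: "z \<in> S \<Longrightarrow> dt Q z = m z - Q z * q z"
    and dt_e: "z \<in> S \<Longrightarrow> dt e z = 2 * e z * (\<alpha> z * m z + q z * \<beta> z)"
begin

section \<open>The three Liouville potentials in reduced variables\<close>

definition U1 :: field where "U1 z = 2 * a z - 3 * b z - 3 * Q z"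

definition V1 :: field where
  "V1 z = ds a z - 2 * ds b z + (a z)\<^sup>2 - 3 * a z * b z + 2 * (b z)\<^sup>2
     - 4 * Q z * a z + 6 * Q z * b z + 3 * (Q z)\<^sup>2 - e z"

text \<open>Obtained by solving \<open>s2 = 0\<close> for \<open>w1\<close>, which makes that
  constraint automatic. That it agrees with \<open>P3\<close> is checked separately in
  \<open>Liouville_potentials\<close>.\<close>

definition W1 :: field where
  "W1 z = - (Q z * (V1 z + (Q z)\<^sup>2 - 3 * ds Q z - ds U1 z) + ds (ds Q) z + ((Q z)\<^sup>2 - ds Q z) * U1 z)"

lemmas smooth_ds = smooth[THEN smooth_on_ds[OF open_S]]

lemma smooth_U1: "smooth_on S U1"
  unfolding U1_def[abs_def] by (intro smooth_on_intros open_S smooth)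

lemma smooth_V1: "smooth_on S V1"
  unfolding V1_def[abs_def] by (intro smooth_on_intros open_S smooth smooth_ds)

lemmas smooth_dds = smooth_ds[THEN smooth_on_ds[OF open_S]]

lemma smooth_W1: "smooth_on S W1"
  unfolding W1_def[abs_def]
  by (intro smooth_on_intros open_S smooth smooth_ds smooth_dds smooth_U1 smooth_V1 smooth_on_ds[OF open_S smooth_U1])

section \<open>Evolution equations and constraints in reduced variables\<close>

lemmas slice_ds = field_has_slice_derivatives(1)[OF smooth(1)] field_has_slice_derivatives(1)[OF smooth(2)]
  field_has_slice_derivatives(1)[OF smooth(3)] field_has_slice_derivatives(1)[OF smooth(4)]
  field_has_slice_derivatives(1)[OF smooth(5)] field_has_slice_derivatives(1)[OF smooth(6)]
  field_has_slice_derivatives(1)[OF smooth(7)] field_has_slice_derivatives(1)[OF smooth(8)]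
  field_has_slice_derivatives(1)[OF smooth_ds(1)] field_has_slice_derivatives(1)[OF smooth_ds(2)]
  field_has_slice_derivatives(1)[OF smooth_ds(3)] field_has_slice_derivatives(1)[OF smooth_ds(4)]
  field_has_slice_derivatives(1)[OF smooth_U1]

lemmas slice_dt = field_has_slice_derivatives(2)[OF smooth(1)] field_has_slice_derivatives(2)[OF smooth(2)]
  field_has_slice_derivatives(2)[OF smooth(3)] field_has_slice_derivatives(2)[OF smooth(8)]
  field_has_slice_derivatives(2)[OF smooth_ds(1)] field_has_slice_derivatives(2)[OF smooth_ds(2)]
  field_has_slice_derivatives(2)[OF smooth_ds(3)] field_has_slice_derivatives(2)[OF smooth_dds(3)]
  field_has_slice_derivatives(2)[OF smooth_U1] field_has_slice_derivatives(2)[OF smooth_on_ds[OF open_S smooth_U1]]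
  field_has_slice_derivatives(2)[OF smooth_V1]

lemmas ds_rules = ds_q ds_\<alpha> ds_m ds_\<beta> ds_e

text \<open>In the space derivative of \<open>\<alpha> m\<close> the contributions of
  \<open>a\<close> and \<open>b\<close> from the two factors are opposite and cancel.\<close>

lemma dt_a_eq:
  assumes "z \<in> S"
  shows "dt a z = - 3 * (q z * e z * m z - m z + \<alpha> z * \<beta> z) - q z * (2 * b z - a z) - \<alpha> z"
proof -
  obtain y t where z: "z = (y, t)" by fastforce
  note slice = slice_ds[OF assms[unfolded z]] and rules = ds_rules[OF assms[unfolded z]]
  show ?thesis
    unfolding dt_a[OF assms] unfolding z
    by (rule ds_eqI) (auto intro!: derivative_eq_intros slice simp: rules algebra_simps)
qed

lemma dt_b_eq:
  assumes "z \<in> S"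
  shows "dt b z = m z + q z * Q z - 2 * (q z * e z * m z + \<alpha> z * \<beta> z)"
proof -
  obtain y t where z: "z = (y, t)" by fastforce
  note slice = slice_ds[OF assms[unfolded z]] and rules = ds_rules[OF assms[unfolded z]]
  show ?thesis
    unfolding dt_b[OF assms] unfolding z
    by (rule ds_eqI) (auto intro!: derivative_eq_intros slice simp: rules algebra_simps)
qed

text \<open>Mixed partial derivatives commute, so the evolution of \<open>ds f\<close> is the space
  derivative of the evolution law \<open>F\<close> of \<open>f\<close>.\<close>

lemma dt_ds_eqI:
  assumes "smooth_on S f" "\<And>z. z \<in> S \<Longrightarrow> dt f z = F z" "(y, t) \<in> S"
    and "((\<lambda>\<xi>. F (\<xi>, t)) has_real_derivative d) (at y)"
  shows "dt (ds f) (y, t) = d"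
  using ds_dt_cong(1)[OF open_S assms(2) smooth_on_dt[OF open_S assms(1)] assms(3)]
    ds_dt_commute[OF open_S assms(1,3)] ds_eqI[OF assms(4)] by simp

lemma ds_ds_q:
  assumes "z \<in> S"
  shows "ds (ds q) z = ds q z * (2 * b z - a z) + q z * (2 * ds b z - ds a z) + ds \<alpha> z"
proof -
  obtain y t where z: "z = (y, t)" by fastforce
  note slice = slice_ds[OF assms[unfolded z]]
  have "ds (ds q) z = ds (\<lambda>z. q z * (2 * b z - a z) + \<alpha> z) z"
    by (rule ds_dt_cong(1)[OF open_S ds_q smooth_ds(4) assms])
  then show ?thesis
    unfolding z by (rule trans[OF _ ds_eqI]) (auto intro!: derivative_eq_intros slice)
qed

lemma ds_U1:
  assumes "z \<in> S"
  shows "ds U1 z = 2 * ds a z - 3 * ds b z - 3 * ds Q z"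
proof -
  obtain y t where z: "z = (y, t)" by fastforce
  note slice = slice_ds[OF assms[unfolded z]]
  show ?thesis
    unfolding z U1_def[abs_def] by (rule ds_eqI) (auto intro!: derivative_eq_intros slice)
qed

text \<open>In the combination \<open>2 a - 3 b - 3 Q\<close> the terms in \<open>q e m\<close>,
  \<open>\<alpha> \<beta>\<close>, \<open>m\<close> and \<open>Q q\<close> cancel; what remains is
  \<open>ds q\<close> up to the factor \<open>- 2\<close>.\<close>

lemma dt_U1:
  assumes "z \<in> S"
  shows "dt U1 z = - 2 * ds q z"
proof -
  obtain y t where z: "z = (y, t)" by fastforce
  note slice = slice_dt[OF assms[unfolded z]]
  have "dt U1 z = 2 * dt a z - 3 * dt b z - 3 * dt Q z"
    unfolding z U1_def[abs_def] by (rule dt_eqI) (auto intro!: derivative_eq_intros slice)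
  then show ?thesis
    by (simp add: dt_a_eq[OF assms] dt_b_eq[OF assms] dt_Q[OF assms] ds_q[OF assms] algebra_simps)
qed

lemma dt_ds_a:
  assumes "z \<in> S"
  shows "dt (ds a) z =
    - 3 * (ds q z * e z * m z + q z * ds e z * m z + q z * e z * ds m z - ds m z
           + ds \<alpha> z * \<beta> z + \<alpha> z * ds \<beta> z)
    - ds q z * (2 * b z - a z) - q z * (2 * ds b z - ds a z) - ds \<alpha> z"
proof -
  obtain y t where z: "z = (y, t)" by fastforce
  note slice = slice_ds[OF assms[unfolded z]]
  show ?thesis
    unfolding z
    by (rule dt_ds_eqI[OF smooth(1) dt_a_eq assms[unfolded z]])
       (auto intro!: derivative_eq_intros slice simp: algebra_simps)
qed

lemma dt_ds_b:
  assumes "z \<in> S"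
  shows "dt (ds b) z = ds m z + ds q z * Q z + q z * ds Q z
    - 2 * (ds q z * e z * m z + q z * ds e z * m z + q z * e z * ds m z + ds \<alpha> z * \<beta> z + \<alpha> z * ds \<beta> z)"
proof -
  obtain y t where z: "z = (y, t)" by fastforce
  note slice = slice_ds[OF assms[unfolded z]]
  show ?thesis
    unfolding z
    by (rule dt_ds_eqI[OF smooth(2) dt_b_eq assms[unfolded z]])
       (auto intro!: derivative_eq_intros slice simp: algebra_simps)
qed

lemma dt_ds_Q:
  assumes "z \<in> S"
  shows "dt (ds Q) z = \<beta> z + m z * (a z - b z) - ds Q z * q z - Q z * ds q z"
proof -
  obtain y t where z: "z = (y, t)" by fastforce
  note slice = slice_ds[OF assms[unfolded z]]
  show ?thesis
    unfolding z
    by (rule dt_ds_eqI[OF smooth(3) dt_Q assms[unfolded z]])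
       (auto intro!: derivative_eq_intros slice simp: ds_m[OF assms[unfolded z]])
qed

lemma dt_ds_ds_Q:
  assumes "z \<in> S"
  shows "dt (ds (ds Q)) z = ds \<beta> z + ds m z * (a z - b z) + m z * (ds a z - ds b z)
    - ds (ds Q) z * q z - 2 * ds Q z * ds q z - Q z * ds (ds q) z"
proof -
  obtain y t where z: "z = (y, t)" by fastforce
  note slice = slice_ds[OF assms[unfolded z]]
  show ?thesis
    unfolding z
    by (rule dt_ds_eqI[OF smooth_ds(3) dt_ds_Q assms[unfolded z]])
       (auto intro!: derivative_eq_intros slice)
qed

lemma dt_ds_U1:
  assumes "z \<in> S"
  shows "dt (ds U1) z = - 2 * ds (ds q) z"
proof -
  obtain y t where z: "z = (y, t)" by fastforce
  note slice = slice_ds[OF assms[unfolded z]]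
  show ?thesis
    unfolding z
    by (rule dt_ds_eqI[OF smooth_U1 dt_U1 assms[unfolded z]])
       (auto intro!: derivative_eq_intros slice)
qed

lemma dt_V1:
  assumes "z \<in> S"
  shows "dt V1 z = - ds (ds q) z - U1 z * ds q z - 2 * ds (\<lambda>z. Q z * q z) z"
proof -
  obtain y t where z: "z = (y, t)" by fastforce
  note slice = slice_dt[OF assms[unfolded z]] slice_ds[OF assms[unfolded z]]
  have "dt V1 z = dt (ds a) z - 2 * dt (ds b) z + 2 * a z * dt a z - 3 * (dt a z * b z + a z * dt b z)
      + 4 * b z * dt b z - 4 * (dt Q z * a z + Q z * dt a z) + 6 * (dt Q z * b z + Q z * dt b z)
      + 6 * Q z * dt Q z - dt e z"
    unfolding z V1_def[abs_def]
    by (rule dt_eqI) (auto intro!: derivative_eq_intros slice simp: algebra_simps)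
  moreover have "ds (\<lambda>z. Q z * q z) z = ds Q z * q z + Q z * ds q z"
    unfolding z by (rule ds_eqI) (auto intro!: derivative_eq_intros slice)
  \<comment> \<open>After the substitutions both sides are polynomials in the reduced variables and
    in \<open>ds a\<close>, \<open>ds b\<close>, \<open>ds Q\<close>, which may be treated as
    independent.\<close>
  ultimately show ?thesis
    unfolding dt_ds_a[OF assms] dt_ds_b[OF assms] dt_a_eq[OF assms] dt_b_eq[OF assms]
      dt_Q[OF assms] dt_e[OF assms] ds_ds_q[OF assms] ds_rules[OF assms] U1_def
    by algebra
qed

text \<open>\<open>W1\<close> is built from \<open>U1\<close>, \<open>V1\<close>, \<open>Q\<close>
  and their space derivatives, whose evolution is already known, so no further time derivative of
  \<open>a\<close> or \<open>b\<close> has to be expanded.\<close>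

lemma dt_W1:
  assumes "z \<in> S"
  shows "dt W1 z = - ds (\<lambda>z. Q z * ds q z + q z * (U1 z * Q z + 2 * (Q z)\<^sup>2 - ds Q z)) z"
proof -
  obtain y t where z: "z = (y, t)" by fastforce
  note slice = slice_dt[OF assms[unfolded z]] slice_ds[OF assms[unfolded z]]
  have "dt W1 z = - (dt Q z * (V1 z + (Q z)\<^sup>2 - 3 * ds Q z - ds U1 z)
      + Q z * (dt V1 z + 2 * Q z * dt Q z - 3 * dt (ds Q) z - dt (ds U1) z)
      + dt (ds (ds Q)) z + (2 * Q z * dt Q z - dt (ds Q) z) * U1 z + ((Q z)\<^sup>2 - ds Q z) * dt U1 z)"
    unfolding z W1_def[abs_def]
    by (rule dt_eqI) (auto intro!: derivative_eq_intros slice simp: algebra_simps)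
  moreover have "ds (\<lambda>z. Q z * ds q z + q z * (U1 z * Q z + 2 * (Q z)\<^sup>2 - ds Q z)) z
      = ds Q z * ds q z + Q z * ds (ds q) z + ds q z * (U1 z * Q z + 2 * (Q z)\<^sup>2 - ds Q z)
        + q z * (ds U1 z * Q z + U1 z * ds Q z + 4 * Q z * ds Q z - ds (ds Q) z)"
    unfolding z by (rule ds_eqI) (auto intro!: derivative_eq_intros slice simp: algebra_simps)
  moreover have "ds (\<lambda>z. Q z * q z) z = ds Q z * q z + Q z * ds q z"
    unfolding z by (rule ds_eqI) (auto intro!: derivative_eq_intros slice)
  ultimately show ?thesis
    unfolding dt_V1[OF assms] dt_U1[OF assms] dt_ds_U1[OF assms] dt_ds_ds_Q[OF assms] dt_ds_Q[OF assms]
      dt_Q[OF assms] ds_U1[OF assms] ds_ds_q[OF assms] ds_rules[OF assms] U1_def V1_def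
    by algebra
qed

text \<open>Purely spatial: this is \<open>p - p_xx = v\<close> in the new variables. The constant
  \<open>1\<close> in \<open>s1\<close> offsets the \<open>- 1\<close> in
  \<open>ds_\<alpha>\<close>, which stems from \<open>v\<close>.\<close>

lemma s1_zero:
  assumes "z \<in> S"
  shows "s1 U1 V1 Q q z = 0"
  unfolding s1_def ds_ds_q[OF assms] ds_rules[OF assms] U1_def V1_def
  by algebra

lemma s2_zero: "s2 U1 V1 W1 Q z = 0"
  by (simp add: s2_def W1_def)

end

section \<open>Solutions of the Novikov system\<close>

text \<open>Both sides are the mixed derivative of \<open>ln \<bar>f\<bar>\<close>; the quotient
  rule shows it without a logarithm and for either sign of \<open>f\<close>.\<close>

lemma dt_log_derivative:
  fixes f :: field
  assumes "open S" "smooth_on S f" "z \<in> S" "f z \<noteq> 0"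
  shows "dt (\<lambda>z. ds f z / f z) z = ds (\<lambda>z. dt f z / f z) z"
proof -
  obtain x t where z: "z = (x, t)" by fastforce
  note S = assms(3)[unfolded z]
  have "dt (\<lambda>z. ds f z / f z) z = (dt (ds f) z * f z - ds f z * dt f z) / (f z * f z)"
    unfolding z using assms(4)
    by (intro dt_eqI DERIV_divide field_has_slice_derivatives(2)[OF _ S] smooth_on_ds assms(1,2)) (simp add: z)
  moreover have "ds (\<lambda>z. dt f z / f z) z = (ds (dt f) z * f z - dt f z * ds f z) / (f z * f z)"
    unfolding z using assms(4)
    by (intro ds_eqI DERIV_divide field_has_slice_derivatives(1)[OF _ S] smooth_on_dt assms(1,2)) (simp add: z)
  ultimately show ?thesis
    by (simp add: ds_dt_commute[OF assms(1-3)] mult.commute)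
qed

text \<open>The new fields are prescribed only on the image of the transformation. As that image is
  open, all derivatives in the system are determined by the values there.\<close>

lemma associated_novikov3_cong:
  assumes "open S" "associated_novikov3 S u1 v1 w1 Q3 q1"
    and eq: "\<And>z. z \<in> S \<Longrightarrow> u1 z = u1' z" "\<And>z. z \<in> S \<Longrightarrow> v1 z = v1' z" "\<And>z. z \<in> S \<Longrightarrow> w1 z = w1' z"
      "\<And>z. z \<in> S \<Longrightarrow> Q3 z = Q3' z" "\<And>z. z \<in> S \<Longrightarrow> q1 z = q1' z"
  shows "associated_novikov3 S u1' v1' w1' Q3' q1'"
proof -
  have sm: "smooth_on S u1" "smooth_on S v1" "smooth_on S w1" "smooth_on S Q3" "smooth_on S q1"
    using assms(2) by (simp_all add: associated_novikov3_def)
  have sm': "smooth_on S u1'" "smooth_on S v1'" "smooth_on S w1'" "smooth_on S Q3'" "smooth_on S q1'"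
    by (rule smooth_on_cong[OF assms(1)], rule sm, erule eq)+
  note ds_sm = smooth_on_ds[OF assms(1)]
  have ds1: "ds u1 z = ds u1' z" "ds Q3 z = ds Q3' z" "ds q1 z = ds q1' z"
    and dt1: "dt u1 z = dt u1' z" "dt v1 z = dt v1' z" "dt w1 z = dt w1' z" if "z \<in> S" for z
    using that by (simp_all add: ds_dt_cong[OF assms(1) eq(1) sm(1)] ds_dt_cong[OF assms(1) eq(2) sm(2)]
        ds_dt_cong[OF assms(1) eq(3) sm(3)] ds_dt_cong[OF assms(1) eq(4) sm(4)] ds_dt_cong[OF assms(1) eq(5) sm(5)])
  have ds2: "ds (ds Q3) z = ds (ds Q3') z" if "z \<in> S" for z
    by (rule ds_dt_cong(1)[OF assms(1) ds1(2) ds_sm[OF sm(4)] that])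
  have ds3: "ds (ds q1) z = ds (ds q1') z" if "z \<in> S" for z
    by (rule ds_dt_cong(1)[OF assms(1) ds1(3) ds_sm[OF sm(5)] that])
  have f1: "ds (\<lambda>z. Q3 z * q1 z) z = ds (\<lambda>z. Q3' z * q1' z) z" if "z \<in> S" for z
    by (rule ds_dt_cong(1)[OF assms(1) _ _ that]) (auto simp: eq intro!: smooth_on_intros sm assms(1))
  have f2: "ds (\<lambda>z. Q3 z * ds q1 z + q1 z * (u1 z * Q3 z + 2 * (Q3 z)\<^sup>2 - ds Q3 z)) z
     = ds (\<lambda>z. Q3' z * ds q1' z + q1' z * (u1' z * Q3' z + 2 * (Q3' z)\<^sup>2 - ds Q3' z)) z" if "z \<in> S" for z
    by (rule ds_dt_cong(1)[OF assms(1) _ _ that]) (auto simp: eq ds1 intro!: smooth_on_intros sm ds_sm assms(1))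
  show ?thesis
    using assms(2) sm'
    by (simp add: associated_novikov3_def s1_def s2_def eq ds1 dt1 ds2 ds3 f1 f2)
qed

section \<open>Reduced variables attached to a solution\<close>

locale novikov_solution =
  fixes T :: "real set" and u v w p r :: field
  assumes open_times: "open T"
    and system: "novikov3 T u v w p r"
    and nonzero: "\<forall>z\<in>UNIV \<times> T. u z \<noteq> 0 \<and> v z \<noteq> 0"
    and decay: "decaying T u p r"
begin

lemma smooth_components:
  "smooth_on (UNIV \<times> T) u" "smooth_on (UNIV \<times> T) v" "smooth_on (UNIV \<times> T) w"
  "smooth_on (UNIV \<times> T) p" "smooth_on (UNIV \<times> T) r"
  using system by (simp_all add: novikov3_def)

sublocale reciprocal_transformation T u "\<lambda>z. u z * p z * r z"
proof
  show "smooth_on (UNIV \<times> T) (\<lambda>z. u z * p z * r z)"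
    by (intro smooth_on_intros smooth_components open_Times open_times open_UNIV)
  show "dt u z = - ds (\<lambda>z. u z * p z * r z) z" if "z \<in> UNIV \<times> T" for z
    using system that unfolding novikov3_def eq_neg_iff_add_eq_0 by blast
  show "uniform_limit K (\<lambda>x t. u (x, t) * p (x, t) * r (x, t)) (\<lambda>_. 0) at_bot" if "compact K" "K \<subseteq> T" for K
    using decay that by (simp add: decaying_def)
qed (use open_times smooth_components nonzero decay in \<open>auto simp: decaying_def\<close>)

lemma equations:
  assumes "z \<in> UNIV \<times> T"
  shows "dt u z = - (ds u z * p z * r z) - u z * (ds p z * r z + p z * ds r z)"
    and "dt v z = - 3 * v z * ds p z * r z - ds v z * p z * r z - (u z)\<^sup>2 * p z"
    and "dt w z = - 3 * w z * p z * ds r z - ds w z * p z * r z + (u z)\<^sup>2 * r z"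
    and "ds (ds p) z = p z - v z" and "ds (ds r) z = r z - w z"
proof -
  have pde: "dt v z + 3 * v z * ds p z * r z + ds v z * p z * r z + (u z)\<^sup>2 * p z = 0"
      "dt w z + 3 * w z * p z * ds r z + ds w z * p z * r z - (u z)\<^sup>2 * r z = 0"
      "v z = p z - ds (ds p) z" "w z = r z - ds (ds r) z"
    using system assms unfolding novikov3_def helmholtz_def by blast+
  obtain x t where z: "z = (x, t)" by fastforce
  note slice = smooth_components[THEN field_has_slice_derivatives(1), OF assms[unfolded z]]
  have "ds (\<lambda>z. u z * p z * r z) z = ds u z * p z * r z + u z * (ds p z * r z + p z * ds r z)"
    unfolding z by (rule ds_eqI) (auto intro!: derivative_eq_intros slice simp: algebra_simps)
  then show "dt u z = - (ds u z * p z * r z) - u z * (ds p z * r z + p z * ds r z)"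
    using conservation[OF assms] by simp
  show "dt v z = - 3 * v z * ds p z * r z - ds v z * p z * r z - (u z)\<^sup>2 * p z"
    and "dt w z = - 3 * w z * p z * ds r z - ds w z * p z * r z + (u z)\<^sup>2 * r z"
    and "ds (ds p) z = p z - v z" and "ds (ds r) z = r z - w z"
    using pde by linarith+
qed

definition a :: field where "a z = ds (pull v) z / pull v z"
definition b :: field where "b z = ds (pull u) z / pull u z"
definition Q :: field where "Q z = pull v z * pull w z / (pull u z) ^ 3"
definition q :: field where "q z = pull p z * (pull u z)\<^sup>2 / pull v z"
definition m :: field where "m z = pull v z * pull r z / pull u z"
definition \<alpha> :: field where "\<alpha> z = pull u z * pull (ds p) z / pull v z"
definition \<beta> :: field where "\<beta> z = pull v z * pull (ds r) z / (pull u z)\<^sup>2"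
definition e :: field where "e z = 1 / (pull u z)\<^sup>2"

lemmas reduced_defs = a_def b_def Q_def q_def m_def \<alpha>_def \<beta>_def e_def

lemma pull_nonzero: "z \<in> \<Omega> \<Longrightarrow> pull u z \<noteq> 0" "z \<in> \<Omega> \<Longrightarrow> pull v z \<noteq> 0"
  using nonzero liouville_inv_in unfolding pull_def by blast+

lemmas smooth_pulls = smooth_components[THEN smooth_pull]
  smooth_components[THEN smooth_on_ds[OF open_domain], THEN smooth_pull]

lemma smooth_reduced:
  "smooth_on \<Omega> a" "smooth_on \<Omega> b" "smooth_on \<Omega> Q" "smooth_on \<Omega> q"
  "smooth_on \<Omega> m" "smooth_on \<Omega> \<alpha>" "smooth_on \<Omega> \<beta>" "smooth_on \<Omega> e"
  unfolding reduced_defs[abs_def]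
  by (intro smooth_on_intros open_\<Omega> smooth_pulls smooth_on_ds[OF open_\<Omega>] power_not_zero pull_nonzero; assumption)+

text \<open>The Helmholtz relations replace second derivatives of \<open>p\<close> and
  \<open>r\<close> by undifferentiated fields; this is what closes the reduced system.\<close>

lemma ds_pull:
  assumes "z \<in> \<Omega>"
  shows "ds (pull u) z = b z * pull u z" "ds (pull v) z = a z * pull v z"
    and "ds (pull p) z = pull (ds p) z / pull u z" "ds (pull r) z = pull (ds r) z / pull u z"
    and "ds (pull (ds p)) z = (pull p z - pull v z) / pull u z"
    and "ds (pull (ds r)) z = (pull r z - pull w z) / pull u z"
  using pull_nonzero[OF assms] equations(4,5)[OF liouville_inv_in[OF assms]]
    smooth_components smooth_components[THEN smooth_on_ds[OF open_domain]]
  by (simp_all add: pull_derivatives(1)[OF _ assms] a_def b_def) (simp_all add: pull_def)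

text \<open>The new time derivative follows the flow with velocity \<open>p r\<close>, so the
  transport terms of the three equations disappear and no space derivative of \<open>u\<close>,
  \<open>v\<close> or \<open>w\<close> is left.\<close>

lemma dt_pull:
  assumes "z \<in> \<Omega>"
  shows "dt (pull u) z = - pull u z * (\<alpha> z * m z + q z * \<beta> z)"
    and "dt (pull v) z = pull v z * (- 3 * (\<alpha> z * m z) - q z)"
    and "dt (pull w) z = - 3 * pull w z * (q z * \<beta> z) + (pull u z)\<^sup>2 * pull r z"
proof -
  let ?w = "liouville_inv z"
  have nz: "u ?w \<noteq> 0" "v ?w \<noteq> 0"
    using pull_nonzero[OF assms] by (auto simp: pull_def)
  then have m: "\<alpha> z * m z = ds p ?w * r ?w" "q z * \<beta> z = p ?w * ds r ?w" "pull v z * q z = (u ?w)\<^sup>2 * p ?w"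
    by (simp_all add: \<alpha>_def m_def q_def \<beta>_def pull_def)
  note t = pull_derivatives(2)[OF _ assms]
  show "dt (pull u) z = - pull u z * (\<alpha> z * m z + q z * \<beta> z)"
    unfolding t[OF smooth_components(1)] m using nz equations(1)[OF liouville_inv_in[OF assms]]
    by (simp add: pull_def algebra_simps)
  have "dt (pull v) z = - 3 * pull v z * (\<alpha> z * m z) - pull v z * q z"
    unfolding t[OF smooth_components(2)] m using nz equations(2)[OF liouville_inv_in[OF assms]]
    by (simp add: pull_def algebra_simps)
  then show "dt (pull v) z = pull v z * (- 3 * (\<alpha> z * m z) - q z)"
    by (simp add: algebra_simps)
  show "dt (pull w) z = - 3 * pull w z * (q z * \<beta> z) + (pull u z)\<^sup>2 * pull r z"
    unfolding t[OF smooth_components(3)] m using nz equations(3)[OF liouville_inv_in[OF assms]]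
    by (simp add: pull_def algebra_simps)
qed

lemma slice_pull:
  assumes "(y, t) \<in> \<Omega>"
  shows "((\<lambda>\<xi>. pull u (\<xi>, t)) has_real_derivative b (y, t) * pull u (y, t)) (at y)"
    and "((\<lambda>\<xi>. pull v (\<xi>, t)) has_real_derivative a (y, t) * pull v (y, t)) (at y)"
    and "((\<lambda>\<xi>. pull w (\<xi>, t)) has_real_derivative ds (pull w) (y, t)) (at y)"
    and "((\<lambda>\<xi>. pull p (\<xi>, t)) has_real_derivative pull (ds p) (y, t) / pull u (y, t)) (at y)"
    and "((\<lambda>\<xi>. pull r (\<xi>, t)) has_real_derivative pull (ds r) (y, t) / pull u (y, t)) (at y)"
    and "((\<lambda>\<xi>. pull (ds p) (\<xi>, t)) has_real_derivative (pull p (y, t) - pull v (y, t)) / pull u (y, t)) (at y)"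
    and "((\<lambda>\<xi>. pull (ds r) (\<xi>, t)) has_real_derivative (pull r (y, t) - pull w (y, t)) / pull u (y, t)) (at y)"
  using smooth_pulls[THEN field_has_slice_derivatives(1), OF assms] ds_pull[OF assms] by simp_all

sublocale reduced_system \<Omega> a b Q q m \<alpha> \<beta> e
proof
  show "open \<Omega>" by (rule open_\<Omega>)
  fix z assume z: "z \<in> \<Omega>"
  obtain y t where yt: "z = (y, t)" by fastforce
  note slice = slice_pull[OF z[unfolded yt]] and nz = pull_nonzero[OF z[unfolded yt]]
  note slice_t = smooth_pulls(1-3)[THEN field_has_slice_derivatives(2), OF z[unfolded yt],
      unfolded dt_pull[OF z[unfolded yt]]]
  show "ds q z = q z * (2 * b z - a z) + \<alpha> z"
    unfolding yt q_def[abs_def] \<alpha>_def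
    by (rule ds_eqI) (use nz in \<open>auto intro!: derivative_eq_intros slice simp: field_simps power2_eq_square\<close>)
  show "ds \<alpha> z = q z * e z - 1 + \<alpha> z * (b z - a z)"
    unfolding yt \<alpha>_def[abs_def] q_def e_def
    by (rule ds_eqI) (use nz in \<open>auto intro!: derivative_eq_intros slice simp: field_simps power2_eq_square\<close>)
  show "ds m z = \<beta> z + m z * (a z - b z)"
    unfolding yt m_def[abs_def] \<beta>_def
    by (rule ds_eqI) (use nz in \<open>auto intro!: derivative_eq_intros slice simp: field_simps power2_eq_square\<close>)
  show "ds \<beta> z = m z * e z - Q z + \<beta> z * (a z - 2 * b z)"
    unfolding yt \<beta>_def[abs_def] m_def e_def Q_def
    by (rule ds_eqI) (use nz in \<open>auto intro!: derivative_eq_intros slice simp: field_simps power2_eq_square power3_eq_cube\<close>)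
  show "ds e z = - 2 * b z * e z"
    unfolding yt e_def[abs_def]
    by (rule ds_eqI) (use nz in \<open>auto intro!: derivative_eq_intros slice simp: field_simps power2_eq_square\<close>)
  show "dt e z = 2 * e z * (\<alpha> z * m z + q z * \<beta> z)"
    unfolding yt e_def[abs_def]
    by (rule dt_eqI) (use nz in \<open>auto intro!: derivative_eq_intros slice_t simp: field_simps power2_eq_square\<close>)
  \<comment> \<open>The contributions of \<open>v\<close>, \<open>w\<close> and
    \<open>u^(-3)\<close> are listed in turn; those in \<open>\<alpha> m\<close> and
    \<open>q \<beta>\<close> cancel.\<close>
  have "dt Q z = Q z * (- 3 * (\<alpha> z * m z) - q z) - 3 * Q z * (q z * \<beta> z)
      + pull v z * ((pull u z)\<^sup>2 * pull r z) / (pull u z) ^ 3 + 3 * Q z * (\<alpha> z * m z + q z * \<beta> z)"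
    unfolding yt Q_def[abs_def]
    by (rule dt_eqI) (use nz in \<open>auto intro!: derivative_eq_intros slice_t simp: field_simps power2_eq_square power3_eq_cube\<close>)
  moreover have "pull v z * ((pull u z)\<^sup>2 * pull r z) / (pull u z) ^ 3 = m z"
    using pull_nonzero[OF z] by (simp add: m_def field_simps power2_eq_square power3_eq_cube)
  ultimately show "dt Q z = m z - Q z * q z"
    by (simp add: algebra_simps)
  have quot: "smooth_on \<Omega> (\<lambda>z. dt (pull f) z / pull f z)" "dt (\<lambda>z. ds (pull f) z / pull f z) z = ds (\<lambda>z. dt (pull f) z / pull f z) z"
    if "smooth_on \<Omega> (pull f)" "\<And>z. z \<in> \<Omega> \<Longrightarrow> pull f z \<noteq> 0" for f
    by (intro smooth_on_intros open_\<Omega> smooth_on_dt that; assumption)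
       (intro dt_log_derivative[OF open_\<Omega>] that z)
  show "dt a z = ds (\<lambda>z. - 3 * (\<alpha> z * m z) - q z) z"
    unfolding a_def[abs_def]
    by (rule trans[OF quot(2)[OF smooth_pulls(2) pull_nonzero(2)]
          ds_dt_cong(1)[OF open_\<Omega> _ quot(1)[OF smooth_pulls(2) pull_nonzero(2)] z]], assumption+)
       (use pull_nonzero in \<open>simp add: dt_pull\<close>)
  show "dt b z = ds (\<lambda>z. - (\<alpha> z * m z) - q z * \<beta> z) z"
    unfolding b_def[abs_def]
    by (rule trans[OF quot(2)[OF smooth_pulls(1) pull_nonzero(1)]
          ds_dt_cong(1)[OF open_\<Omega> _ quot(1)[OF smooth_pulls(1) pull_nonzero(1)] z]], assumption+)
       (use pull_nonzero in \<open>simp add: dt_pull\<close>)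
qed (rule smooth_reduced)+

lemma reduced_associated_novikov3: "associated_novikov3 \<Omega> U1 V1 W1 Q q"
  using smooth smooth_U1 smooth_V1 smooth_W1
  by (simp add: associated_novikov3_def dt_U1 dt_V1 dt_W1 s1_zero s2_zero)

section \<open>Old space derivatives in terms of the reduced variables\<close>

lemma pull_ds: "smooth_on (UNIV \<times> T) f \<Longrightarrow> z \<in> \<Omega> \<Longrightarrow> pull (ds f) z = pull u z * ds (pull f) z"
  using pull_nonzero by (simp add: pull_derivatives)

lemma pull_ds_ds:
  assumes "smooth_on (UNIV \<times> T) f" "\<And>z. z \<in> \<Omega> \<Longrightarrow> pull (ds f) z = F z" "(y, t) \<in> \<Omega>"
    and "((\<lambda>\<xi>. F (\<xi>, t)) has_real_derivative d) (at y)"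
  shows "pull (ds (ds f)) (y, t) = pull u (y, t) * d"
proof -
  have sm: "smooth_on (UNIV \<times> T) (ds f)"
    by (rule smooth_on_ds[OF open_domain assms(1)])
  have "ds (pull (ds f)) (y, t) = ds F (y, t)"
    by (rule ds_dt_cong(1)[OF open_\<Omega> assms(2) smooth_pull[OF sm] assms(3)])
  then show ?thesis
    by (simp add: pull_ds[OF sm assms(3)] ds_eqI[OF assms(4)])
qed

text \<open>Eliminates \<open>w\<close>, which may vanish and so has no logarithmic derivative, in
  favour of \<open>Q\<close>.\<close>

lemma pull_w: "z \<in> \<Omega> \<Longrightarrow> pull w z = Q z * (pull u z) ^ 3 / pull v z"
  using pull_nonzero by (simp add: Q_def)

lemma pull_ds_components:
  assumes "z \<in> \<Omega>"
  shows "pull (ds u) z = (pull u z)\<^sup>2 * b z"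
    and "pull (ds v) z = pull u z * a z * pull v z"
    and "pull (ds w) z = (pull u z) ^ 4 / pull v z * (ds Q z + Q z * (3 * b z - a z))"
proof -
  obtain y t where z: "z = (y, t)" by fastforce
  note slice = slice_pull[OF assms[unfolded z]] slice_ds[OF assms[unfolded z]] and nz = pull_nonzero[OF assms[unfolded z]]
  show "pull (ds u) z = (pull u z)\<^sup>2 * b z" "pull (ds v) z = pull u z * a z * pull v z"
    using pull_ds[OF smooth_components(1) assms] pull_ds[OF smooth_components(2) assms] ds_pull[OF assms]
    by (simp_all add: power2_eq_square)
  have "ds (pull w) z = ds (\<lambda>z. Q z * (pull u z) ^ 3 / pull v z) z"
    by (rule ds_dt_cong(1)[OF open_\<Omega> pull_w smooth_pulls(3) assms])
  also have "\<dots> = (pull u z) ^ 3 / pull v z * (ds Q z + Q z * (3 * b z - a z))"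
    unfolding z
    by (rule ds_eqI)
       (use nz in \<open>auto intro!: derivative_eq_intros slice simp: field_simps power2_eq_square power3_eq_cube\<close>)
  finally show "pull (ds w) z = (pull u z) ^ 4 / pull v z * (ds Q z + Q z * (3 * b z - a z))"
    unfolding pull_ds[OF smooth_components(3) assms] by (simp add: power_numeral_reduce)
qed

lemma pull_ds_ds_components:
  assumes "z \<in> \<Omega>"
  shows "pull (ds (ds u)) z = (pull u z) ^ 3 * (2 * (b z)\<^sup>2 + ds b z)"
    and "pull (ds (ds v)) z = (pull u z)\<^sup>2 * pull v z * (b z * a z + ds a z + (a z)\<^sup>2)"
    and "pull (ds (ds w)) z = (pull u z) ^ 5 / pull v z *
      ((4 * b z - a z) * (ds Q z + Q z * (3 * b z - a z))
        + ds (ds Q) z + ds Q z * (3 * b z - a z) + Q z * (3 * ds b z - ds a z))"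
proof -
  obtain y t where z: "z = (y, t)" by fastforce
  note z\<Omega> = assms[unfolded z]
  note slice = slice_pull[OF z\<Omega>] slice_ds[OF z\<Omega>] and nz = pull_nonzero[OF z\<Omega>]
  have "pull (ds (ds u)) z = pull u z * (2 * pull u z * (b z * pull u z) * b z + (pull u z)\<^sup>2 * ds b z)"
    unfolding z by (rule pull_ds_ds[OF smooth_components(1) pull_ds_components(1) z\<Omega>])
      (auto intro!: derivative_eq_intros slice simp: algebra_simps)
  then show "pull (ds (ds u)) z = (pull u z) ^ 3 * (2 * (b z)\<^sup>2 + ds b z)"
    by (simp add: algebra_simps power2_eq_square power3_eq_cube)
  have "pull (ds (ds v)) z = pull u z * (b z * pull u z * a z * pull v z
      + pull u z * ds a z * pull v z + pull u z * a z * (a z * pull v z))"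
    unfolding z by (rule pull_ds_ds[OF smooth_components(2) pull_ds_components(2) z\<Omega>])
      (auto intro!: derivative_eq_intros slice simp: algebra_simps)
  then show "pull (ds (ds v)) z = (pull u z)\<^sup>2 * pull v z * (b z * a z + ds a z + (a z)\<^sup>2)"
    by (simp add: algebra_simps power2_eq_square)
  have "pull (ds (ds w)) z = pull u z * ((pull u z) ^ 4 / pull v z *
      ((4 * b z - a z) * (ds Q z + Q z * (3 * b z - a z))
        + ds (ds Q) z + ds Q z * (3 * b z - a z) + Q z * (3 * ds b z - ds a z)))"
    unfolding z by (rule pull_ds_ds[OF smooth_components(3) pull_ds_components(3) z\<Omega>])
      (use nz in \<open>auto intro!: derivative_eq_intros slice
        simp: field_simps power2_eq_square power3_eq_cube power4_eq_xxxx\<close>)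
  then show "pull (ds (ds w)) z = (pull u z) ^ 5 / pull v z *
      ((4 * b z - a z) * (ds Q z + Q z * (3 * b z - a z))
        + ds (ds Q) z + ds Q z * (3 * b z - a z) + Q z * (3 * ds b z - ds a z))"
    by (simp add: power_numeral_reduce)
qed

text \<open>Once everything is written in reduced variables, the powers of \<open>u\<close> and
  \<open>v\<close> cancel except for \<open>1 / u^2\<close>, which is \<open>e\<close>. Since
  \<open>W1\<close> was defined by \<open>s2 = 0\<close>, the third identity is where that
  constraint is verified for \<open>P3\<close>.\<close>

lemma Liouville_potentials:
  assumes "z \<in> \<Omega>"
  shows "pull (P1 u v w) z = U1 z" "pull (P2 u v w) z = V1 z" "pull (P3 u v w) z = W1 z"
proof -
  \<comment> \<open>Here \<open>x\<close> and \<open>y\<close> are the values of \<open>u\<close>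
    and \<open>v\<close>, not coordinates; the claims become rational identities with nonzero
    denominators.\<close>
  define x y where "x = pull u z" and "y = pull v z"
  have nz: "x \<noteq> 0" "y \<noteq> 0"
    using pull_nonzero[OF assms] by (auto simp: x_def y_def)
  note rules = pull_w[OF assms] pull_ds_components[OF assms] pull_ds_ds_components[OF assms]
  note rules' = rules[folded x_def y_def, unfolded pull_def] x_def[symmetric, unfolded pull_def] y_def[symmetric, unfolded pull_def]
  have e: "e z = 1 / x\<^sup>2" by (simp add: e_def x_def)
  show "pull (P1 u v w) z = U1 z"
    unfolding U1_def pull_def P1_def rules' using nz
    by (simp add: field_simps power2_eq_square power3_eq_cube)
  show "pull (P2 u v w) z = V1 z"
    unfolding V1_def pull_def P2_def rules' e using nz
    by (simp add: field_simps power2_eq_square power3_eq_cube power_numeral_reduce)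
  show "pull (P3 u v w) z = W1 z"
    unfolding W1_def V1_def U1_def ds_U1[OF assms] pull_def P3_def rules' e using nz
    by (simp add: field_simps power2_eq_square power3_eq_cube power_numeral_reduce)
qed

end

theorem proposition3:
  fixes T :: "real set" and u v w p r :: "real \<times> real \<Rightarrow> real"
  assumes "open T"
    and "novikov3 T u v w p r"
    and "\<forall>z\<in>UNIV \<times> T. u z \<noteq> 0 \<and> v z \<noteq> 0"
    and "decaying T u p r"
  shows "diffeomorphism_on (UNIV \<times> T) (liouville u) \<and>
         (\<forall>u1 v1 w1 Q3 q1.
           (\<forall>z\<in>UNIV \<times> T.
              u1 (liouville u z) = P1 u v w z \<and>
              v1 (liouville u z) = P2 u v w z \<and>
              w1 (liouville u z) = P3 u v w z \<and>
              Q3 (liouville u z) = v z * w z / (u z)^3 \<and>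
              q1 (liouville u z) = p z * (u z)\<^sup>2 / v z)
           \<longrightarrow> associated_novikov3 (liouville u ` (UNIV \<times> T)) u1 v1 w1 Q3 q1)"
proof -
  interpret novikov_solution T u v w p r
    using assms by unfold_locales
  have "associated_novikov3 (liouville u ` (UNIV \<times> T)) u1 v1 w1 Q3 q1"
    if fields: "\<forall>z\<in>UNIV \<times> T.
              u1 (liouville u z) = P1 u v w z \<and>
              v1 (liouville u z) = P2 u v w z \<and>
              w1 (liouville u z) = P3 u v w z \<and>
              Q3 (liouville u z) = v z * w z / (u z)^3 \<and>
              q1 (liouville u z) = p z * (u z)\<^sup>2 / v z"
    for u1 v1 w1 Q3 q1
  proof -
    \<comment> \<open>Every point of the image is \<open>liouville u\<close> of its preimage, so the
      prescribed values leave no freedom on \<open>\<Omega>\<close>.\<close>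
    have "u1 z = U1 z \<and> v1 z = V1 z \<and> w1 z = W1 z \<and> Q3 z = Q z \<and> q1 z = q z" if "z \<in> \<Omega>" for z
      using fields[rule_format, OF liouville_inv_in[OF that]] Liouville_potentials[OF that]
      by (simp add: liouville_inv_right[OF that] pull_def Q_def q_def)
    then show ?thesis
      unfolding \<Omega>_def[symmetric]
      by (intro associated_novikov3_cong[OF open_\<Omega> reduced_associated_novikov3]) simp_all
  qed
  with diffeomorphism_liouville show ?thesis by blast
qed

end
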